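(* Let $n\ge 52$ and let $p$ be a nonnegative integer with $p<(n-1)(n-3)$. Then there exists a symmetric set $S\subseteq S_n$ with $|S|=p$, $\iota_n\notin S$ and $\delta_n\notin S$ if and only if (exactly) one of the following holds: (1) $p=qn-r$ for some integers $0\le r\le q<n-3$; (2) $n$ is even and $p=\frac{n(n-3)}{2}+c(n-1)$ for some integer $c\ge 0$; (3) $n$ is odd and $p=\binom{n-1}{2}+cn$ for some integer $c\ge 0$.
   Context: $S_n$ is the symmetric group on $[n]=\{1,\dots,n\}$; permutations are written in one-line notation. For $w\in S_n$, $\mathrm{Des}(w)=\{i\in[n-1] : w(i)>w(i+1)\}$. For $D\subseteq[n-1]$, $F_{n,D}=\sum x_{i_1}\cdots x_{i_n}$, summed over $i_1\le\cdots\le i_n$ with $i_j<i_{j+1}$ whenever $j\in D$ (Gessel's fundamental quasisymmetric function). For $S\subseteq S_n$, $Q(S)=\sum_{w\in S}F_{n,\mathrm{Des}(w)}$, and $S$ is symmetric if $Q(S)$ is a symmetric function. $\iota_n=12\cdots n$ and $\delta_n=n\cdots 21$. *)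

theory Defs
  imports "HOL-Combinatorics.Permutations"
begin

definition Sym :: "nat \<Rightarrow> (nat \<Rightarrow> nat) set" where
  "Sym n = {w. w permutes {1..n}}"

definition Des :: "nat \<Rightarrow> (nat \<Rightarrow> nat) \<Rightarrow> nat set" where
  "Des n w = {i \<in> {1..n-1}. w i > w (i+1)}"

definition iota :: "nat \<Rightarrow> nat \<Rightarrow> nat" where
  "iota n = id"

definition delta :: "nat \<Rightarrow> nat \<Rightarrow> nat" where
  "delta n = (\<lambda>i. if i \<in> {1..n} then n + 1 - i else i)"

text \<open>Formal power series in commuting variables x_0, x_1, ... are represented
  by their coefficient functions on monomials; a monomial is an exponent
  vector alpha :: nat => nat (finitely supported).  The coefficient of the
  monomial alpha in Gessel's fundamental quasisymmetric function F_{n,D}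
  is the number of index sequences i_1 <= ... <= i_n, strict at positions j in D,
  with x_{i_1} ... x_{i_n} = x^alpha.  Sequences are lists, position j is at list index j-1.\<close>

definition F_coeff :: "nat \<Rightarrow> nat set \<Rightarrow> (nat \<Rightarrow> nat) \<Rightarrow> nat" where
  "F_coeff n D alpha = card {is :: nat list. length is = n \<and>
      (\<forall>j. 1 \<le> j \<and> j < n \<longrightarrow> is ! (j-1) \<le> is ! j \<and> (j \<in> D \<longrightarrow> is ! (j-1) < is ! j)) \<and>
      (\<forall>k. count (mset is) k = alpha k)}"

definition Q_coeff :: "nat \<Rightarrow> (nat \<Rightarrow> nat) set \<Rightarrow> (nat \<Rightarrow> nat) \<Rightarrow> nat" where
  "Q_coeff n S alpha = (\<Sum>w\<in>S. F_coeff n (Des n w) alpha)"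

text \<open>A power series is a symmetric function iff it is invariant under every
  permutation of the variables (all series here are homogeneous of degree n).\<close>
definition symmetric_set :: "nat \<Rightarrow> (nat \<Rightarrow> nat) set \<Rightarrow> bool" where
  "symmetric_set n S \<longleftrightarrow>
     (\<forall>pi alpha. bij pi \<longrightarrow> Q_coeff n S (alpha \<circ> pi) = Q_coeff n S alpha)"

end

(* Let c(D) be the number of elements of S with descent set D.  Symmetry of Q(S) says exactly that
   the sum of c over all descent words matching a list of blocks separated by free letters does not
   depend on the order of the blocks.  Permuting n div 2 one-letter blocks, and using
   (n div 2) choose 3 >= (n - 1) (n - 3) for n >= 52, shows that a D with c(D) > 0 cannot contain
   three pairwise non-adjacent elements while its complement has five elements.  Hence D or its
   complement is a "low" set: one or two short runs.  Writing h_1 h_k = h_(k+1) + (ribbon with a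
   single descent) repeatedly, block permutations evaluate the sum of c over the low sets as
       (n - 1) c{1} + n (n - 3) / 2 * c{1,n-1} + n c{1,2,n-1} + (c{1,2} - c{1,2,3} + c{1,2,3,4}),
   and the non-negativity of c on a few more sets bounds these parameters so tightly that below
   (n - 1) (n - 3) only the listed sizes survive.  The complementary sets contribute a sum of the
   same form.  Conversely each listed size is realised with descent sets of at most two elements,
   taking c{i} and c{i,j} to depend only on whether i is extreme and whether i, j are adjacent. *)
theory Submission
  imports Defs "HOL.Binomial_Plus"
begin

text \<open>A block sum is the value, on a product of noncommutative ribbons, of the linear
  functional sending the ribbon with descent set D to c(D); symmetry of Q(S) says that this
  functional cannot see the order of the factors. The obstacle is that Q(S) has non-negative
  coefficients at the F_D but need not be Schur positive: the sum of F_D over D = {1}, {n - 1} and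
  all {i, i + 1} is symmetric, has n terms, and equals s_(n-1,1) + s_(n-2,1,1) - s_(n-2,2). This
  function makes n, besides n - 1, a generator of the possible sizes. As Schur coefficients may be
  negative, the bounds have to come from c(D) >= 0 for well-chosen D, and that is why the identities
  below compute the values at rather special sets such as {4}, {4,5} and {2,n-2}.\<close>

section \<open>Sums over descent words matching a list of blocks\<close>

text \<open>A block \<open>(k, A)\<close> covers \<open>k\<close> consecutive entries of a permutation and prescribes its \<open>k - 1\<close>
  inner letters (descents exactly at \<open>A \<subseteq> {1..<k}\<close>); the letter between two consecutive blocks
  (a cut) is free.\<close>
type_synonym block = "nat \<times> nat set"

fun block_ones :: "nat \<Rightarrow> block list \<Rightarrow> nat set" where
  "block_ones off [] = {}"
| "block_ones off ((k, A) # bs) = (+) off ` A \<union> block_ones (off + k) bs"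

fun block_cuts :: "nat \<Rightarrow> block list \<Rightarrow> nat set" where
  "block_cuts off [] = {}"
| "block_cuts off [b] = {}"
| "block_cuts off (b # b' # bs) = insert (off + fst b) (block_cuts (off + fst b) (b' # bs))"

definition psum :: "(nat set \<Rightarrow> nat) \<Rightarrow> nat set \<Rightarrow> nat set \<Rightarrow> nat" where
  "psum c A J = (\<Sum>X\<in>Pow J. c (A \<union> X))"

definition block_sum :: "(nat set \<Rightarrow> nat) \<Rightarrow> block list \<Rightarrow> nat" where
  "block_sum c bs = psum c (block_ones 0 bs) (block_cuts 0 bs)"

abbreviation blocks_size :: "block list \<Rightarrow> nat" where
  "blocks_size bs \<equiv> sum_list (map fst bs)"

definition valid_blocks :: "block list \<Rightarrow> bool" where
  "valid_blocks bs \<longleftrightarrow> (\<forall>(k, A)\<in>set bs. 0 < k \<and> A \<subseteq> {1..<k})"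

lemma valid_blocks_simps [simp]:
  "valid_blocks []"
  "valid_blocks ((k, A) # bs) \<longleftrightarrow> 0 < k \<and> A \<subseteq> {1..<k} \<and> valid_blocks bs"
  "valid_blocks (bs @ bs') \<longleftrightarrow> valid_blocks bs \<and> valid_blocks bs'"
  by (auto simp: valid_blocks_def)

lemma psum_empty [simp]: "psum c A {} = c A"
  by (simp add: psum_def)

lemma psum_insert:
  assumes "finite J" "x \<notin> J"
  shows "psum c A (insert x J) = psum c A J + psum c (insert x A) J"
proof -
  have "Pow J \<inter> insert x ` Pow J = {}" using assms by auto
  moreover have "inj_on (insert x) (Pow J)"
    using assms(2) by (auto simp: inj_on_def)
  ultimately show ?thesis using assms(1)
    by (simp add: psum_def Pow_insert sum.union_disjoint sum.reindex)
qed

lemma finite_block_cuts [simp]: "finite (block_cuts off bs)"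
  by (induction off bs rule: block_cuts.induct) auto

lemma block_ones_append:
  "block_ones off (bs @ bs') = block_ones off bs \<union> block_ones (off + blocks_size bs) bs'"
  by (induction off bs rule: block_ones.induct) (auto simp: add.assoc)

lemma block_cuts_split:
  "block_cuts off (bs @ (a, A) # (b, B) # bs')
     = insert (off + blocks_size bs + a) (block_cuts off (bs @ (a + b, C) # bs'))"
proof (induction bs arbitrary: off)
  case Nil
  then show ?case by (cases bs') (auto simp: add.assoc)
next
  case (Cons x bs)
  from Cons[of "off + fst x"] show ?case
    by (cases bs) (auto simp: add.assoc)
qed

lemma block_cuts_gt:
  assumes "valid_blocks bs" "x \<in> block_cuts off bs"
  shows "off < x"
  using assms
  by (induction off bs rule: block_cuts.induct) force+

lemma block_cuts_split_fresh:
  assumes "valid_blocks bs" "valid_blocks bs'" "0 < a" "0 < b"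
  shows "off + blocks_size bs + a \<notin> block_cuts off (bs @ (a + b, C) # bs')"
  using assms(1)
proof (induction bs arbitrary: off)
  case Nil
  show ?case
  proof (cases bs')
    case (Cons y ys)
    have "off + (a + b) < x" if "x \<in> block_cuts (off + (a + b)) (y # ys)" for x
      using block_cuts_gt[OF _ that] assms(2) Cons by simp
    then show ?thesis using Cons assms(4) by fastforce
  qed simp
next
  case (Cons x bs)
  obtain k A where x: "x = (k, A)" by fastforce
  obtain y ys where y: "bs @ (a + b, C) # bs' = y # ys" by (cases bs) auto
  from Cons.IH[of "off + k"] Cons.prems x y assms(3) show ?case
    by (auto simp: add.assoc)
qed

text \<open>The border letter of two adjacent blocks is free, so the sum splits according to whether
  it is an ascent or a descent. This is the product rule for ribbons.\<close>

lemma block_sum_split: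
  assumes "valid_blocks bs" "valid_blocks bs'" "0 < a" "0 < b"
  shows "block_sum c (bs @ (a, A) # (b, B) # bs')
           = block_sum c (bs @ (a + b, A \<union> (+) a ` B) # bs')
           + block_sum c (bs @ (a + b, insert a (A \<union> (+) a ` B)) # bs')"
proof -
  have 1: "block_ones 0 (bs @ (a, A) # (b, B) # bs') = block_ones 0 (bs @ (a + b, A \<union> (+) a ` B) # bs')"
    by (auto simp: block_ones_append image_Un image_image add.assoc)
  have 2: "block_ones 0 (bs @ (a + b, insert a (A \<union> (+) a ` B)) # bs')
      = insert (blocks_size bs + a) (block_ones 0 (bs @ (a + b, A \<union> (+) a ` B) # bs'))"
    by (auto simp: block_ones_append image_Un image_image add.assoc)
  have 3: "block_cuts 0 (bs @ (a + b, C) # bs') = block_cuts 0 (bs @ (a + b, D) # bs')" for C D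
    by (metis block_cuts_split block_cuts_split_fresh[OF assms] Diff_insert_absorb)
  show ?thesis
    unfolding block_sum_def block_cuts_split[of 0 bs a A b B bs' "A \<union> (+) a ` B"] 1 2
    using block_cuts_split_fresh[OF assms, of 0]
    by (simp add: psum_insert 3[of "insert a (A \<union> (+) a ` B)" "A \<union> (+) a ` B"])
qed

definition perm_inv :: "nat \<Rightarrow> (nat set \<Rightarrow> nat) \<Rightarrow> bool" where
  "perm_inv n c \<longleftrightarrow> (\<forall>bs bs'. valid_blocks bs \<longrightarrow> blocks_size bs = n \<longrightarrow> mset bs = mset bs'
     \<longrightarrow> block_sum c bs = block_sum c bs')"

lemma perm_invD:
  assumes "perm_inv n c" "mset bs = mset bs'" "valid_blocks bs" "blocks_size bs = n"
  shows "block_sum c bs = block_sum c bs'"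
  using assms by (auto simp: perm_inv_def)

lemma valid_blocks_mset: "mset bs = mset bs' \<Longrightarrow> valid_blocks bs = valid_blocks bs'"
  unfolding valid_blocks_def using mset_eq_setD[of bs bs'] by simp

text \<open>A one at an inner position \<open>a\<close> of a block is traded for a cut at \<open>a\<close> minus a zero at \<open>a\<close>.\<close>
lemma perm_inv_from_empty_blocks:
  assumes hom: "\<And>ks ks'. \<lbrakk>\<forall>k\<in>set ks. 0 < k; sum_list ks = n; mset ks = mset ks'\<rbrakk> \<Longrightarrow>
     block_sum c (map (\<lambda>k. (k, {})) ks) = block_sum c (map (\<lambda>k. (k, {})) ks')"
  shows "perm_inv n c"
  unfolding perm_inv_def
proof (intro allI impI)
  fix bs bs' :: "block list"
  assume "valid_blocks bs" "blocks_size bs = n" "mset bs = mset bs'"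
  then show "block_sum c bs = block_sum c bs'"
  proof (induction "sum_list (map (card \<circ> snd) bs)" arbitrary: bs bs' rule: less_induct)
    case less
    show ?case
    proof (cases "\<exists>b\<in>set bs. snd b \<noteq> {}")
      case False
      have all: "set bs' = set bs" using less.prems(3) mset_eq_setD by metis
      have emp: "(fst b, {}) = b" if "b \<in> set bs" for b
        using False that by (cases b) auto
      have e: "map (\<lambda>k. (k, {})) (map fst bs) = bs" "map (\<lambda>k. (k, {})) (map fst bs') = bs'"
        unfolding map_map o_def by (rule map_idI, simp add: emp all)+
      have pos: "\<forall>k\<in>set (map fst bs). 0 < k"
        using less.prems(1) by (auto simp: valid_blocks_def)
      have m: "mset (map fst bs) = mset (map fst bs')"
        using less.prems(3) by simp
      show ?thesis using hom[OF pos less.prems(2) m] unfolding e .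
    next
      case True
      then obtain k A where kA: "(k, A) \<in> set bs" "A \<noteq> {}" by force
      then obtain a where a: "a \<in> A" by auto
      obtain b1 b2 where bs: "bs = b1 @ (k, A) # b2" using kA by (meson split_list)
      have "(k, A) \<in> set bs'" using kA less.prems(3) mset_eq_setD by metis
      then obtain b1' b2' where bs': "bs' = b1' @ (k, A) # b2'" by (meson split_list)
      have v': "valid_blocks bs'" using less.prems(1,3) valid_blocks_mset by blast
      have kk: "0 < k" "A \<subseteq> {1..<k}" using less.prems(1) bs by auto
      define A1 where "A1 = A \<inter> {..<a}"
      \<comment> \<open>The letters behind \<open>a\<close>, renumbered from the start of the second
        of two blocks of lengths \<open>a\<close> and \<open>k - a\<close>.\<close>
      define A2 where "A2 = (\<lambda>x. x - a) ` (A \<inter> {a<..})"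
      have fin: "finite A" using kk finite_subset by blast
      have ak: "0 < a" "a < k" using a kk by auto
      have im: "(+) a ` A2 = A \<inter> {a<..}"
        by (auto simp: A2_def image_image)
      have un: "A1 \<union> (+) a ` A2 = A - {a}" unfolding im by (auto simp: A1_def)
      have ins: "insert a (A - {a}) = A" using a by auto
      have inj: "inj_on (\<lambda>x. x - a) (A \<inter> {a<..})" by (auto simp: inj_on_def)
      have "card A2 = card (A \<inter> {a<..})" unfolding A2_def by (rule card_image[OF inj])
      moreover have "card (A1 \<union> A \<inter> {a<..}) = card A1 + card (A \<inter> {a<..})"
        using fin by (intro card_Un_disjoint) (auto simp: A1_def)
      ultimately have cd: "card A1 + card A2 = card (A - {a})"
        using un im by simp
      have lt: "card (A - {a}) < card A" using a fin by (meson card_Diff1_less)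
      have s: "block_sum c (x @ (a, A1) # (k - a, A2) # y)
          = block_sum c (x @ (k, A - {a}) # y) + block_sum c (x @ (k, A) # y)"
        if "valid_blocks x" "valid_blocks y" for x y
        using block_sum_split[OF that, of a "k - a" c A1 A2] ak un ins by auto
      have "1 \<le> x - a" "x - a < k - a" if "x \<in> A" "a < x" for x
        using that kk by auto
      then have "A2 \<subseteq> {1..<k - a}" by (auto simp: A2_def)
      then have "valid_blocks (b1 @ (a, A1) # (k - a, A2) # b2)"
        using less.prems(1) bs ak kk by (auto simp: A1_def)
      \<comment> \<open>Both the split list and the list with \<open>A - {a}\<close> prescribe one
        descent fewer than \<open>bs\<close>, so the induction hypothesis covers the two sums whose
        difference is wanted.\<close>
      then have 1: "block_sum c (b1 @ (a, A1) # (k - a, A2) # b2)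
            = block_sum c (b1' @ (a, A1) # (k - a, A2) # b2')"
        using less.prems ak lt cd bs bs' by (intro less.hyps) auto
      have 2: "block_sum c (b1 @ (k, A - {a}) # b2) = block_sum c (b1' @ (k, A - {a}) # b2')"
        using less.prems lt bs bs' by (intro less.hyps) auto
      have "valid_blocks b1" "valid_blocks b2" "valid_blocks b1'" "valid_blocks b2'"
        using less.prems(1) v' bs bs' by auto
      with s[of b1 b2] s[of b1' b2'] 1 2 show ?thesis
        unfolding bs bs' by simp
    qed
  qed
qed

section \<open>Complementation of descent words\<close>

lemma block_ones_bounds:
  assumes "valid_blocks bs" "x \<in> block_ones off bs"
  shows "off < x \<and> x < off + blocks_size bs"
  using assms
proof (induction off bs rule: block_ones.induct)
  case (2 off k A bs)
  then consider "x \<in> (+) off ` A" | "x \<in> block_ones (off + k) bs" by auto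
  then show ?case using 2 by cases (force+)
qed auto

lemma block_cuts_lt:
  assumes "valid_blocks bs" "x \<in> block_cuts off bs"
  shows "x < off + blocks_size bs"
  using assms
proof (induction off bs rule: block_cuts.induct)
  case (3 off b b' bs)
  then show ?case by (cases b; cases b') (force simp: add.assoc)
qed auto

lemma block_ones_cuts_disjoint:
  assumes "valid_blocks bs"
  shows "block_ones off bs \<inter> block_cuts off bs = {}"
  using assms
proof (induction off bs rule: block_cuts.induct)
  case (3 off b b' bs)
  obtain k A where b: "b = (k, A)" by fastforce
  have gt: "off + k < x" if "x \<in> block_cuts (off + k) (b' # bs)" for x
    using block_cuts_gt[OF _ that] 3 b by simp
  have gt': "off + k < x" if "x \<in> block_ones (off + k) (b' # bs)" for x
    using block_ones_bounds[OF _ that] 3 b by simp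
  have lt: "x < off + k" if "x \<in> (+) off ` A" for x using that 3(2) b by auto
  have IH: "block_ones (off + k) (b' # bs) \<inter> block_cuts (off + k) (b' # bs) = {}"
    using 3 b by simp
  show ?case using b gt gt' lt IH by (fastforce simp del: block_ones.simps(2) simp: block_ones.simps(2)[of off k A])
qed auto

abbreviation compl_blocks :: "block list \<Rightarrow> block list" where
  "compl_blocks \<equiv> map (\<lambda>(k, A). (k, {1..<k} - A))"

lemma block_cuts_compl [simp]: "block_cuts off (compl_blocks bs) = block_cuts off bs"
  by (induction off bs rule: block_cuts.induct) (auto split: prod.splits)

lemma block_ones_compl:
  assumes "valid_blocks bs"
  shows "block_ones off (compl_blocks bs)
    = {off<..<off + blocks_size bs} - block_cuts off bs - block_ones off bs"
  using assms
proof (induction off bs rule: block_cuts.induct)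
  case (2 off b)
  obtain k A where b: "b = (k, A)" by fastforce
  have "(+) off ` ({1..<k} - A) = {off<..<off + k} - (+) off ` A"
  proof (intro set_eqI iffI)
    fix x assume "x \<in> {off<..<off + k} - (+) off ` A"
    then have "x = off + (x - off)" "x - off \<in> {1..<k} - A" by (auto simp: image_iff)
    then show "x \<in> (+) off ` ({1..<k} - A)" by blast
  qed auto
  then show ?case using b by simp
next
  case (3 off b b' bs)
  obtain k A where b: "b = (k, A)" by fastforce
  have kA: "0 < k" "A \<subseteq> {1..<k}" using 3(2) b by auto
  define r where "r = blocks_size (b' # bs)"
  define C where "C = block_cuts (off + k) (b' # bs)"
  define B where "B = block_ones (off + k) (b' # bs)"
  have v: "valid_blocks (b' # bs)" using 3(2) b by simp
  have r0: "0 < r" using v by (cases b') (auto simp: r_def)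
  have C: "C \<subseteq> {off + k<..}" using block_cuts_gt[OF v] by (auto simp: C_def)
  have B: "B \<subseteq> {off + k<..}" using block_ones_bounds[OF v] by (auto simp: B_def)
  have IH: "block_ones (off + k) (compl_blocks (b' # bs)) = {off + k<..<off + k + r} - C - B"
    using 3(1) v b by (simp add: r_def C_def B_def)
  have 1: "(+) off ` ({1..<k} - A) = {off<..<off + k} - (+) off ` A"
  proof (intro set_eqI iffI)
    fix x assume "x \<in> {off<..<off + k} - (+) off ` A"
    then have "x = off + (x - off)" "x - off \<in> {1..<k} - A" by (auto simp: image_iff)
    then show "x \<in> (+) off ` ({1..<k} - A)" by blast
  qed auto
  have A: "(+) off ` A \<subseteq> {off<..<off + k}" using kA by auto
  have L: "block_ones off (compl_blocks (b # b' # bs))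
      = ({off<..<off + k} - (+) off ` A) \<union> ({off + k<..<off + k + r} - C - B)"
    unfolding IH[symmetric] 1[symmetric] using b by simp
  have R: "block_cuts off (b # b' # bs) = insert (off + k) C"
    "block_ones off (b # b' # bs) = (+) off ` A \<union> B"
    "blocks_size (b # b' # bs) = k + r"
    using b by (simp_all add: C_def B_def r_def)
  show ?case unfolding L R
  proof (intro set_eqI iffI)
    fix x assume "x \<in> {off<..<off + (k + r)} - insert (off + k) C - ((+) off ` A \<union> B)"
    then show "x \<in> ({off<..<off + k} - (+) off ` A) \<union> ({off + k<..<off + k + r} - C - B)"
      by (cases x "off + k" rule: linorder_cases) auto
  next
    fix x assume x: "x \<in> ({off<..<off + k} - (+) off ` A) \<union> ({off + k<..<off + k + r} - C - B)"
    show "x \<in> {off<..<off + (k + r)} - insert (off + k) C - ((+) off ` A \<union> B)"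
    proof (cases "x < off + k")
      case True
      then have "x \<notin> C" "x \<notin> B" using C B by auto
      then show ?thesis using x True r0 by auto
    next
      case False
      then have "x \<notin> (+) off ` A" using A by auto
      then show ?thesis using x False kA by auto
    qed
  qed
qed simp

text \<open>Complementation carries the words matching a block list to those matching the list with
  complemented blocks; the free letters are flipped as well, which only reindexes the sum. Results
  on sets with few descents thereby transfer to sets with few ascents.\<close>

lemma perm_inv_compl:
  assumes "perm_inv n c"
  shows "perm_inv n (\<lambda>D. c ({1..<n} - D))"
proof -
  have "block_sum (\<lambda>D. c ({1..<n} - D)) bs = block_sum c (compl_blocks bs)"
    if v: "valid_blocks bs" and n: "blocks_size bs = n" for bs
  proof -
    let ?C = "block_cuts 0 bs" and ?A = "block_ones 0 bs"
    have C: "?C \<subseteq> {1..<n}" using block_cuts_gt[OF v] block_cuts_lt[OF v] n by fastforce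
    have dis: "?A \<inter> ?C = {}" using block_ones_cuts_disjoint[OF v] .
    have "(\<Sum>X\<in>Pow ?C. c ({1..<n} - (?A \<union> X)))
        = (\<Sum>X\<in>Pow ?C. c (({0<..<n} - ?C - ?A) \<union> X))"
    proof (rule sum.reindex_bij_witness[where i = "\<lambda>X. ?C - X" and j = "\<lambda>X. ?C - X"])
      fix X assume "X \<in> Pow ?C"
      then have "({0<..<n} - ?C - ?A) \<union> (?C - X) = {1..<n} - (?A \<union> X)"
        using C dis by fastforce
      then show "c (({0<..<n} - ?C - ?A) \<union> (?C - X)) = c ({1..<n} - (?A \<union> X))" by simp
    qed auto
    moreover have "block_ones 0 (compl_blocks bs) = {0<..<n} - ?C - ?A"
      unfolding block_ones_compl[OF v] n[symmetric] add_0 ..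
    ultimately show ?thesis
      by (simp only: block_sum_def psum_def block_cuts_compl)
  qed
  note compl_sum = this
  have vc: "valid_blocks (compl_blocks bs)" if "valid_blocks bs" for bs
    using that by (auto simp: valid_blocks_def)
  have sc: "blocks_size (compl_blocks bs) = blocks_size bs" for bs
    by (induction bs) auto
  have sm: "blocks_size bs = blocks_size bs'" if "mset bs = mset bs'" for bs bs' :: "block list"
    using that by (metis mset_map sum_mset_sum_list)
  show ?thesis
    unfolding perm_inv_def
  proof (intro allI impI)
    fix bs bs' assume v: "valid_blocks bs" and n: "blocks_size bs = n" and m: "mset bs = mset bs'"
    have "block_sum c (compl_blocks bs) = block_sum c (compl_blocks bs')"
      using m by (intro perm_invD[OF assms] vc v) (simp_all only: sc n mset_map)
    then show "block_sum (\<lambda>D. c ({1..<n} - D)) bs = block_sum (\<lambda>D. c ({1..<n} - D)) bs'"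
      using compl_sum[of bs] compl_sum[of bs'] v n m sm[OF m] valid_blocks_mset[OF m] by metis
  qed
qed

section \<open>Block identities for low descent sets\<close>

definition small :: "nat \<Rightarrow> nat set \<Rightarrow> bool" where
  "small k X \<longleftrightarrow> finite X \<and> card X \<le> k"

lemma small_empty [simp]: "small k {}"
  by (simp add: small_def)

text \<open>As a simp rule this bounds an explicit set by counting insertions, without deciding
  which of its elements coincide.\<close>

lemma small_insert [simp]: "0 < k \<Longrightarrow> small (k - 1) X \<Longrightarrow> small k (insert x X)"
  by (auto simp: small_def card_insert_if)

definition has_sep3 :: "nat set \<Rightarrow> bool" where
  "has_sep3 X \<longleftrightarrow> (\<exists>a\<in>X. \<exists>b\<in>X. a + 2 \<le> b \<and> (\<exists>d\<in>X. b + 2 \<le> d))"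

text \<open>The bound 8 only has to exceed the number of letters that occur in the block identities below
  while staying far from \<open>n\<close>, so that complements of low sets do not interfere.\<close>
locale low_coeffs =
  fixes n :: nat and c :: "nat set \<Rightarrow> nat"
  assumes n_large: "n \<ge> 20"
    and perm_inv: "perm_inv n c"
    and sep3_zero: "\<And>X. \<lbrakk>X \<subseteq> {1..<n}; small 8 X; has_sep3 X\<rbrakk> \<Longrightarrow> c X = 0"
begin

lemmas block_simps = block_sum_def psum_insert insert_commute add_ac numeral_eq_Suc

lemmas zero_simps = sep3_zero has_sep3_def

text \<open>Enlarging a set keeps its separated triple, so such a sum can be discarded without
  expanding its free letters.\<close>

lemma psum_zero:
  assumes "has_sep3 A" "A \<union> J \<subseteq> {1..<n}" "small 8 (A \<union> J)"
  shows "psum c A J = 0"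
proof -
  have "c (A \<union> X) = 0" if "X \<subseteq> J" for X
  proof (rule sep3_zero)
    show "small 8 (A \<union> X)"
      using assms(3) that card_mono[of "A \<union> J" "A \<union> X"] finite_subset[of "A \<union> X" "A \<union> J"]
      by (fastforce simp: small_def)
  qed (use assms that in \<open>auto simp: has_sep3_def\<close>)
  then show ?thesis by (simp add: psum_def)
qed

text \<open>Both sides are the block sum with an extra cut minus the one with the one erased; this is
  \<open>h\<^sub>1 h\<^sub>k = h\<^sub>k h\<^sub>1\<close>.\<close>
lemma flip:
  assumes "valid_blocks bs" "valid_blocks bs'" "0 < k" "m = k + 1"
    "blocks_size bs + blocks_size bs' + m = n"
  shows "block_sum c (bs @ (m, {1}) # bs') = block_sum c (bs @ (m, {k}) # bs')"
proof -
  have "block_sum c (bs @ (1, {}) # (k, {}) # bs') = block_sum c (bs @ (k, {}) # (1, {}) # bs')"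
    using assms by (intro perm_invD[OF perm_inv]) auto
  with block_sum_split[OF assms(1,2), of 1 k c "{}" "{}"] block_sum_split[OF assms(1,2), of k 1 c "{}" "{}"] assms(3)
  show ?thesis by (simp add: add.commute assms(4))
qed

lemma singleton_add_pair:
  assumes "1 \<le> k" "k + 2 \<le> n"
  shows "c {k} + c {k, k + 1} = c {1} + c {1, k + 1}"
proof -
  have "block_sum c [(k + 1, {1}), (n - k - 1, {})] = block_sum c [(k + 1, {k}), (n - k - 1, {})]"
    using flip[of "[]" "[(n - k - 1, {})]" k "k + 1"] assms by simp
  then show ?thesis by (simp add: block_simps)
qed

text \<open>The left side collects all sets whose two clusters start at \<open>k\<close> and
  \<open>k + l + 1\<close>. Moving the two descents to the ends leaves the free letters
  \<open>k + 1\<close> and \<open>n - l - 1\<close>; a descent there avoids a separated triple only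
  next to an end, that is for \<open>k = 1\<close> or \<open>l = 1\<close>, and this produces the
  correction terms.\<close>

lemma two_cluster_sum:
  assumes "1 \<le> k" "1 \<le> l" "1 \<le> r" "k + l + r + 2 = n"
  shows "c {k, k + l + 1} + c {k, k + 1, k + l + 1} + c {k, k + l + 1, k + l + 2} + c {k, k + 1, k + l + 1, k + l + 2}
       = c {1, n - 1} + (if k = 1 then c {1, 2, n - 1} else 0) + (if l = 1 then c {1, n - 2, n - 1} else 0)
        + (if k = 1 \<and> l = 1 then c {1, 2, n - 2, n - 1} else 0)"
proof -
  have "block_sum c [(k + 1, {k}), (l + 1, {l}), (r, {})] = block_sum c [(k + 1, {1}), (l + 1, {l}), (r, {})]"
    using flip[of "[]" "[(l + 1, {l}), (r, {})]" k "k + 1"] assms by simp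
  also have "\<dots> = block_sum c [(k + 1, {1}), (r, {}), (l + 1, {l})]"
    using assms by (intro perm_invD[OF perm_inv]) auto
  finally have eq: "block_sum c [(k + 1, {k}), (l + 1, {l}), (r, {})] = block_sum c [(k + 1, {1}), (r, {}), (l + 1, {l})]" .
  have n: "n = k + l + r + 2" using assms by simp
  consider "k = 1" "l = 1" | "k = 1" "2 \<le> l" | "2 \<le> k" "l = 1" | "2 \<le> k" "2 \<le> l"
    using assms by linarith
  then show ?thesis
    using eq n_large \<open>1 \<le> r\<close>
    by cases (simp add: block_simps zero_simps n)+
qed

lemma two_cluster_sum_last:
  assumes "1 \<le> k" "1 \<le> l" "k + l + 2 = n"
  shows "c {k, k + l + 1} + c {k, k + 1, k + l + 1}
       = c {1, n - 1} + (if k = 1 then c {1, 2, n - 1} else 0) + (if l = 1 then c {1, n - 2, n - 1} else 0)"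
proof -
  have n: "n = k + l + 2" using assms by simp
  have "block_sum c [(k + 1, {k}), (l + 1, {l})] = block_sum c [(k + 1, {1}), (l + 1, {l})]"
    using flip[of "[]" "[(l + 1, {l})]" k "k + 1"] assms by simp
  moreover have "(k = 1 \<and> l = 1) \<or> (k = 1 \<and> 2 \<le> l) \<or> (2 \<le> k \<and> l = 1) \<or> (2 \<le> k \<and> 2 \<le> l)"
    using assms by linarith
  ultimately show ?thesis
    using n_large
    by (elim disjE conjE) (simp add: block_simps zero_simps n)+
qed

text \<open>Exchanging the outer blocks reflects their places but not their contents; one flip then
  moves the descent of the block of length three to its first letter.\<close>

lemma pair_singleton_reverse: "c {1, n - 2, n - 1} = c {1, 2, n - 1}"
proof -
  \<comment> \<open>With \<open>n\<close> written as \<open>t\<close> plus a numeral, all positions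
    become comparable by simp; the same device recurs below.\<close>
  define t where "t = n - 20"
  then have n: "n = t + 20" using n_large by simp
  have "block_sum c [(2, {1}), (t + 15, {}), (3, {2})] = block_sum c [(3, {2}), (t + 15, {}), (2, {1})]"
    using n by (intro perm_invD[OF perm_inv]) auto
  also have "\<dots> = block_sum c [(3, {1}), (t + 15, {}), (2, {1})]"
    using n flip[of "[]" "[(t + 15, {}), (2, {1})]" 2 3] by simp
  finally show ?thesis by (simp add: block_simps zero_simps n)
qed

lemma coeff_13: "c {1, 3} + c {1, 2, 3} = c {1, n - 1} + c {1, 2, n - 1}"
proof -
  define t where "t = n - 20"
  then have n: "n = t + 20" using n_large by simp
  have "block_sum c [(2, {1}), (t + 18, {1})] = block_sum c [(2, {1}), (t + 18, {t + 17})]"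
    using n flip[of "[(2, {1})]" "[]" "t + 17" "t + 18"] by simp
  then show ?thesis by (simp add: block_simps zero_simps n)
qed

text \<open>Flipping the last block sends its descent from \<open>j\<close> to \<open>n - 1\<close>.
  The cut at \<open>j - 1\<close> is then too far from both ends to carry a further descent.\<close>

lemma coeff_1j:
  assumes "4 \<le> j" "j + 2 \<le> n"
  shows "c {1, j} + c {1, j - 1, j} = c {1, n - 1}"
proof -
  obtain x where j: "j = x + 4" using assms(1) le_Suc_ex by (metis add.commute)
  obtain z where n: "n = j + z + 2" using assms(2) le_Suc_ex by (metis add.commute add.assoc)
  have "block_sum c [(x + 3, {1}), (z + 3, {1})] = block_sum c [(x + 3, {1}), (z + 3, {z + 2})]"
    using n j flip[of "[(x + 3, {1})]" "[]" "z + 2" "z + 3"] by simp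
  then show ?thesis by (simp add: block_simps zero_simps n j)
qed

text \<open>A descent at a cut beside the pair would complete a separated triple with 1, so the
  block of the pair can be moved to the front without extra terms.\<close>

lemma coeff_1_pair:
  assumes "5 \<le> j" "j + 2 \<le> n"
  shows "c {1, j - 1, j} = c {1, 2, n - 1}"
proof -
  obtain x where j: "j = x + 5" using assms(1) le_Suc_ex by (metis add.commute)
  obtain z where n: "n = j + z + 2" using assms(2) le_Suc_ex by (metis add.commute add.assoc)
  have "block_sum c [(x + 3, {1}), (3, {1, 2}), (z + 1, {})] = block_sum c [(3, {1, 2}), (z + 1, {}), (x + 3, {1})]"
    using n j by (intro perm_invD[OF perm_inv]) auto
  also have "\<dots> = block_sum c [(3, {1, 2}), (z + 1, {}), (x + 3, {x + 2})]"
    using n j flip[of "[(3, {1, 2}), (z + 1, {})]" "[]" "x + 2" "x + 3"] by simp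
  finally show ?thesis by (simp add: block_simps zero_simps n j)
qed

lemma coeff_134: "c {1, 3, 4} + c {1, 2, 3, 4} = c {1, 2, n - 1} + c {1, 2, n - 2, n - 1}"
proof -
  define t where "t = n - 20"
  then have n: "n = t + 20" using n_large by simp
  have "block_sum c [(2, {1}), (3, {1, 2}), (t + 15, {})] = block_sum c [(3, {1, 2}), (t + 15, {}), (2, {1})]"
    using n by (intro perm_invD[OF perm_inv]) auto
  then show ?thesis by (simp add: block_simps zero_simps n)
qed

lemma pair_then_singleton: "c {2, 3, n - 2} + c {1, 2, n - 2, n - 1} = c {1, 2, n - 1}"
proof -
  define t where "t = n - 20"
  then have n: "n = t + 20" using n_large by simp
  have "block_sum c [(1, {}), (3, {1, 2}), (t + 15, {t + 14}), (1, {})]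
      = block_sum c [(3, {1, 2}), (1, {}), (1, {}), (t + 15, {t + 14})]"
    using n by (intro perm_invD[OF perm_inv]) auto
  moreover have "block_sum c [(1, {}), (3, {1, 2}), (t + 13, {}), (3, {1, 2})]
      = block_sum c [(3, {1, 2}), (1, {}), (t + 13, {}), (3, {1, 2})]"
    using n by (intro perm_invD[OF perm_inv]) auto
  ultimately show ?thesis by (simp add: block_simps zero_simps n)
qed

lemma singleton_then_pair: "c {2, n - 3, n - 2} + c {1, 2, n - 2, n - 1} = c {1, 2, n - 1}"
proof -
  define t where "t = n - 20"
  then have n: "n = t + 20" using n_large by simp
  have "block_sum c [(1, {}), (t + 15, {1}), (3, {1, 2}), (1, {})]
      = block_sum c [(3, {1, 2}), (1, {}), (1, {}), (t + 15, {1})]"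
    using n by (intro perm_invD[OF perm_inv]) auto
  also have "\<dots> = block_sum c [(3, {1, 2}), (1, {}), (1, {}), (t + 15, {t + 14})]"
    using n flip[of "[(3, {1, 2}), (1, {}), (1, {})]" "[]" "t + 14" "t + 15"] by simp
  moreover have "block_sum c [(3, {1, 2}), (t + 13, {}), (3, {1, 2}), (1, {})]
      = block_sum c [(3, {1, 2}), (1, {}), (t + 13, {}), (3, {1, 2})]"
    using n by (intro perm_invD[OF perm_inv]) auto
  ultimately show ?thesis by (simp add: block_simps zero_simps n)
qed

lemma inner_two_pairs: "c {2, 3, n - 3, n - 2} = c {1, 2, n - 2, n - 1}"
proof -
  define t where "t = n - 20"
  then have n: "n = t + 20" using n_large by simp
  have "block_sum c [(1, {}), (3, {1, 2}), (t + 12, {}), (3, {1, 2}), (1, {})]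
      = block_sum c [(3, {1, 2}), (1, {}), (1, {}), (t + 12, {}), (3, {1, 2})]"
    using n by (intro perm_invD[OF perm_inv]) auto
  then show ?thesis by (simp add: block_simps zero_simps psum_zero n)
qed

text \<open>Together with \<open>pair_then_singleton\<close> and \<open>singleton_then_pair\<close>
  this yields \<open>c {2, n - 2} = c {1, n - 1} - 2 * c {1, 2, n - 1} + c {1, 2, n - 2, n -
  1}\<close>, so the right side is non-negative.\<close>

lemma inner_doubletons:
  "c {2, n - 2} + c {2, 3, n - 2} + c {2, n - 3, n - 2} + c {1, 2, n - 2, n - 1} = c {1, n - 1}"
proof -
  define t where "t = n - 20"
  then have n: "n = t + 20" using n_large by simp
  have "block_sum c ([] @ (3, {1}) # [(t + 14, {}), (3, {1})]) = block_sum c ([] @ (3, {2}) # [(t + 14, {}), (3, {1})])"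
    by (rule flip) (use n in simp_all)
  moreover have "block_sum c ([(3, {1}), (t + 14, {})] @ (3, {1}) # []) = block_sum c ([(3, {1}), (t + 14, {})] @ (3, {2}) # [])"
    by (rule flip) (use n in simp_all)
  ultimately have "block_sum c [(3, {2}), (t + 14, {}), (3, {1})] = block_sum c [(3, {1}), (t + 14, {}), (3, {2})]"
    by (simp only: append.simps)
  then have "c {2, n - 2} + c {2, 3, n - 2} + c {2, n - 3, n - 2} + c {2, 3, n - 3, n - 2} = c {1, n - 1}"
    by (simp add: block_simps zero_simps psum_zero n)
  then show ?thesis by (simp only: inner_two_pairs)
qed

text \<open>The position 6 is dictated by \<open>coeff_45\<close>, where two blocks of length three
  put a cut there. The second identity in the proof evaluates the extra term
  \<open>c {1, 2, 6, 7}\<close>.\<close>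

lemma coeff_126: "c {1, 2, 6} + c {1, 2, n - 2, n - 1} = c {1, 2, n - 1}"
proof -
  define t where "t = n - 20"
  then have n: "n = t + 20" using n_large by simp
  have "block_sum c [(3, {1, 2}), (4, {3}), (t + 13, {})] = block_sum c [(3, {1, 2}), (t + 13, {}), (4, {3})]"
    using n by (intro perm_invD[OF perm_inv]) auto
  moreover have "block_sum c [(3, {1, 2}), (2, {}), (3, {1, 2}), (t + 12, {})]
      = block_sum c [(3, {1, 2}), (2, {}), (t + 12, {}), (3, {1, 2})]"
    using n by (intro perm_invD[OF perm_inv]) auto
  ultimately show ?thesis by (simp add: block_simps zero_simps n)
qed

text \<open>A run of five contains a separated triple, so a run of four cannot be extended at a cut
  and its block moves freely.\<close>

lemma four_run:
  assumes "2 \<le> i" "i \<le> 5"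
  shows "c {i, i + 1, i + 2, i + 3} = c {1, 2, 3, 4}"
proof -
  define x t where "x = i - 2" and "t = n - i - 10"
  then have i: "i = x + 2" and n: "n = t + i + 10" using n_large assms by auto
  have "block_sum c [(x + 1, {}), (5, {1, 2, 3, 4}), (t + 6, {})]
      = block_sum c [(5, {1, 2, 3, 4}), (x + 1, {}), (t + 6, {})]"
    using n i by (intro perm_invD[OF perm_inv]) auto
  then show ?thesis using i by (simp add: block_simps zero_simps n i)
qed

lemma three_run:
  assumes "3 \<le> i" "i \<le> 4"
  shows "c {i, i + 1, i + 2} + c {1, 2, 3, 4} = c {1, 2, 3}"
proof -
  define x t where "x = i - 3" and "t = n - i - 10"
  then have i: "i = x + 3" and n: "n = t + i + 10" using n_large assms by auto
  have "block_sum c [(x + 2, {}), (4, {1, 2, 3}), (t + 7, {})]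
      = block_sum c [(4, {1, 2, 3}), (x + 2, {}), (t + 7, {})]"
    using n i by (intro perm_invD[OF perm_inv]) auto
  then show ?thesis using i four_run[of "i - 1"] four_run[of i] assms
    by (simp add: block_simps zero_simps n i)
qed

text \<open>In terms of \<open>c {1, 2} - c {1, 2, 3} + c {1, 2, 3, 4}\<close>, the last summand of
  the total below, this says that \<open>c {4, 5}\<close> exceeds it by \<open>c {1, 2, 6}\<close>.
  The run lemmas eliminate the words in which a cut beside 4, 5 is a descent.\<close>

lemma coeff_45:
  "c {4, 5} + 2 * c {1, 2, 3} = c {1, 2} + c {1, 2, 3} + c {1, 2, 6} + c {1, 2, 3, 4}"
proof -
  define t where "t = n - 20"
  then have n: "n = t + 20" using n_large by simp
  have "block_sum c [(3, {}), (3, {1, 2}), (t + 14, {})]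
      = block_sum c [(3, {1, 2}), (3, {}), (t + 14, {})]"
    using n by (intro perm_invD[OF perm_inv]) auto
  then show ?thesis using three_run[of 3] three_run[of 4] four_run[of 3]
    by (simp add: block_simps zero_simps n)
qed

end

section \<open>The total weight of low descent sets\<close>

context low_coeffs
begin

definition low_sets :: "nat set set" where
  "low_sets = {D. D \<subseteq> {1..<n} \<and> D \<noteq> {} \<and> \<not> has_sep3 D}"

text \<open>The clusters partition the low sets: \<open>k\<close> is the least element,
  \<open>m\<close> in \<open>cluster2\<close> the least element at distance two or more from it, and
  every other element is the upper neighbour of \<open>k\<close> or \<open>m\<close>, as it would
  otherwise complete a separated triple.\<close>

definition cluster1 :: "nat \<Rightarrow> nat set set" where
  "cluster1 k = {D. D \<subseteq> {1..<n} \<and> k \<in> D \<and> D \<subseteq> {k, k + 1}}"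

definition cluster2 :: "nat \<Rightarrow> nat \<Rightarrow> nat set set" where
  "cluster2 m k = {D. D \<subseteq> {1..<n} \<and> k \<in> D \<and> m \<in> D \<and> D \<subseteq> {k, k + 1, m, m + 1}}"

lemma finite_cluster [simp]: "finite (cluster1 k)" "finite (cluster2 m k)"
  by (rule finite_subset[of _ "Pow {1..<n}"]; force simp: cluster1_def cluster2_def)+

lemma low_sets_eq:
  "low_sets = (\<Union>k\<in>{1..<n}. cluster1 k) \<union> (\<Union>m\<in>{3..<n}. \<Union>k\<in>{1..m - 2}. cluster2 m k)"
proof (intro set_eqI iffI)
  fix D assume "D \<in> low_sets"
  then have D: "D \<subseteq> {1..<n}" "D \<noteq> {}" "\<not> has_sep3 D" by (auto simp: low_sets_def)
  define k where "k = (LEAST x. x \<in> D)"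
  have k: "k \<in> D" unfolding k_def using D(2) by (meson LeastI ex_in_conv)
  have k_le: "k \<le> x" if "x \<in> D" for x unfolding k_def using that by (rule Least_le)
  show "D \<in> (\<Union>k\<in>{1..<n}. cluster1 k) \<union> (\<Union>m\<in>{3..<n}. \<Union>k\<in>{1..m - 2}. cluster2 m k)"
  proof (cases "\<exists>x. x \<in> D \<and> k + 2 \<le> x")
    case False
    then have "x = k \<or> x = k + 1" if "x \<in> D" for x using k_le[OF that] that
      by (metis add_2_eq_Suc' le_antisym not_less_eq_eq Suc_eq_plus1)
    then have "D \<in> cluster1 k" using D k by (auto simp: cluster1_def)
    then show ?thesis using D k by blast
  next
    case True
    define m where "m = (LEAST x. x \<in> D \<and> k + 2 \<le> x)"
    have m: "m \<in> D" "k + 2 \<le> m" using LeastI_ex[OF True] by (auto simp: m_def)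
    have m_le: "m \<le> x" if "x \<in> D" "k + 2 \<le> x" for x unfolding m_def using that by (simp add: Least_le)
    have "x = k \<or> x = k + 1 \<or> x = m \<or> x = m + 1" if x: "x \<in> D" for x
    proof (rule ccontr)
      assume "\<not> ?thesis"
      then have "m + 2 \<le> x" using k_le[OF x] m_le[OF x] by linarith
      then have "has_sep3 D" unfolding has_sep3_def using k m x by blast
      then show False using D(3) by blast
    qed
    then have "D \<in> cluster2 m k" using D k m by (auto simp: cluster2_def)
    moreover have "m \<in> {3..<n}" "k \<in> {1..m - 2}" using D k m by auto
    ultimately show ?thesis by blast
  qed
next
  fix D assume "D \<in> (\<Union>k\<in>{1..<n}. cluster1 k) \<union> (\<Union>m\<in>{3..<n}. \<Union>k\<in>{1..m - 2}. cluster2 m k)"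
  moreover have "k + 2 \<le> m" if "m \<in> {3..<n}" "k \<in> {1..m - 2}" for m k using that by auto
  ultimately consider k where "D \<in> cluster1 k" | m k where "k + 2 \<le> m" "D \<in> cluster2 m k"
    by blast
  then show "D \<in> low_sets"
  proof cases
    case 1
    have "\<not> has_sep3 D"
    proof
      assume "has_sep3 D"
      then obtain a b d where abd: "a \<in> D" "b \<in> D" "d \<in> D" "a + 2 \<le> b" "b + 2 \<le> d"
        by (auto simp: has_sep3_def)
      have *: "x = k \<or> x = k + 1" if "x \<in> D" for x
        using that 1 by (auto simp: cluster1_def)
      show False using abd(4,5) *[OF abd(1)] *[OF abd(2)] *[OF abd(3)] by presburger
    qed
    then show ?thesis using 1 by (auto simp: low_sets_def cluster1_def)
  next
    case 2
    have "\<not> has_sep3 D"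
    proof
      assume "has_sep3 D"
      then obtain a b d where abd: "a \<in> D" "b \<in> D" "d \<in> D" "a + 2 \<le> b" "b + 2 \<le> d"
        by (auto simp: has_sep3_def)
      have *: "x = k \<or> x = k + 1 \<or> x = m \<or> x = m + 1" if "x \<in> D" for x
        using that 2 by (auto simp: cluster2_def)
      show False using 2(1) abd(4,5) *[OF abd(1)] *[OF abd(2)] *[OF abd(3)] by presburger
    qed
    then show ?thesis using 2 by (auto simp: low_sets_def cluster2_def)
  qed
qed

lemma cluster1_min: "D \<in> cluster1 k \<Longrightarrow> k = (LEAST x. x \<in> D)"
  by (rule Least_equality[symmetric]) (auto simp: cluster1_def)

lemma cluster2_min:
  assumes D: "D \<in> cluster2 m k" "k + 2 \<le> m"
  shows "k = (LEAST x. x \<in> D)" "m = (LEAST x. x \<in> D \<and> k + 2 \<le> x)"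
proof -
  have sub: "x = k \<or> x = k + 1 \<or> x = m \<or> x = m + 1" if "x \<in> D" for x
    using D(1) that by (auto simp: cluster2_def)
  have kD: "k \<in> D" "m \<in> D" using D(1) by (auto simp: cluster2_def)
  show "k = (LEAST x. x \<in> D)"
  proof (rule Least_equality[symmetric])
    show "k \<le> y" if "y \<in> D" for y using sub[OF that] D(2) by linarith
  qed (rule kD)
  show "m = (LEAST x. x \<in> D \<and> k + 2 \<le> x)"
  proof (rule Least_equality[symmetric])
    show "m \<le> y" if "y \<in> D \<and> k + 2 \<le> y" for y using sub[of y] that by linarith
  qed (use kD D(2) in simp)
qed

lemma cluster12_disjoint:
  assumes "k' + 2 \<le> m" "D \<in> cluster1 k" "D \<in> cluster2 m k'"
  shows False
proof -
  have "k' \<in> D" "m \<in> D" using assms(3) by (auto simp: cluster2_def)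
  then have "k' = k \<or> k' = k + 1" "m = k \<or> m = k + 1" using assms(2) by (auto simp: cluster1_def)
  then show False using assms(1) by linarith
qed

lemma sum_low_sets:
  "sum c low_sets = (\<Sum>k\<in>{1..<n}. sum c (cluster1 k)) + (\<Sum>m\<in>{3..<n}. \<Sum>k\<in>{1..m - 2}. sum c (cluster2 m k))"
proof -
  have 1: "sum c (\<Union>k\<in>{1..<n}. cluster1 k) = (\<Sum>k\<in>{1..<n}. sum c (cluster1 k))"
    using cluster1_min by (intro sum.UNION_disjoint) auto
  have 2: "sum c (\<Union>k\<in>{1..m - 2}. cluster2 m k) = (\<Sum>k\<in>{1..m - 2}. sum c (cluster2 m k))" if "m \<ge> 3" for m
  proof (intro sum.UNION_disjoint ballI impI)
    fix i j assume "i \<in> {1..m - 2}" "j \<in> {1..m - 2}" "i \<noteq> j"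
    then show "cluster2 m i \<inter> cluster2 m j = {}"
      using cluster2_min(1)[of _ m i] cluster2_min(1)[of _ m j] that by fastforce
  qed auto
  have 3: "sum c (\<Union>m\<in>{3..<n}. \<Union>k\<in>{1..m - 2}. cluster2 m k) = (\<Sum>m\<in>{3..<n}. sum c (\<Union>k\<in>{1..m - 2}. cluster2 m k))"
  proof (intro sum.UNION_disjoint ballI impI)
    fix i j assume ij: "i \<in> {3..<n}" "j \<in> {3..<n}" "i \<noteq> j"
    show "(\<Union>k\<in>{1..i - 2}. cluster2 i k) \<inter> (\<Union>k\<in>{1..j - 2}. cluster2 j k) = {}"
    proof (rule ccontr)
      assume "\<not> ?thesis"
      then obtain D k k' where "k \<in> {1..i - 2}" "D \<in> cluster2 i k" "k' \<in> {1..j - 2}" "D \<in> cluster2 j k'" by blast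
      then have D: "D \<in> cluster2 i k" "k + 2 \<le> i" "D \<in> cluster2 j k'" "k' + 2 \<le> j" using ij by auto
      have "k = k'" using cluster2_min(1)[OF D(1,2)] cluster2_min(1)[OF D(3,4)] by simp
      then show False using cluster2_min(2)[OF D(1,2)] cluster2_min(2)[OF D(3,4)] ij(3) by simp
    qed
  qed auto
  have 4: "(\<Union>k\<in>{1..<n}. cluster1 k) \<inter> (\<Union>m\<in>{3..<n}. \<Union>k\<in>{1..m - 2}. cluster2 m k) = {}"
  proof (rule ccontr)
    assume "\<not> ?thesis"
    then obtain D where D: "D \<in> (\<Union>k\<in>{1..<n}. cluster1 k)" "D \<in> (\<Union>m\<in>{3..<n}. \<Union>k\<in>{1..m - 2}. cluster2 m k)"
      by blast
    obtain k where k: "D \<in> cluster1 k" using D(1) by blast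
    obtain m k' where m: "m \<in> {3..<n}" "k' \<in> {1..m - 2}" "D \<in> cluster2 m k'" using D(2) by blast
    have "k' + 2 \<le> m" using m(1,2) by auto
    then show False using cluster12_disjoint k m(3) by blast
  qed
  have 5: "(\<Sum>m\<in>{3..<n}. sum c (\<Union>k\<in>{1..m - 2}. cluster2 m k)) = (\<Sum>m\<in>{3..<n}. \<Sum>k\<in>{1..m - 2}. sum c (cluster2 m k))"
    by (rule sum.cong) (use 2 in auto)
  have "sum c low_sets = sum c (\<Union>k\<in>{1..<n}. cluster1 k) + sum c (\<Union>m\<in>{3..<n}. \<Union>k\<in>{1..m - 2}. cluster2 m k)"
    unfolding low_sets_eq using 4 by (intro sum.union_disjoint) auto
  then show ?thesis by (simp only: 1 3 5)
qed

lemma sum_cluster1: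
  assumes "1 \<le> k" "k + 2 \<le> n"
  shows "sum c (cluster1 k) = c {1} + c {1, k + 1}"
proof -
  have "cluster1 k = {{k}, {k, k + 1}}" using assms by (auto simp: cluster1_def)
  moreover have "{k} \<noteq> {k, k + 1}" by auto
  ultimately show ?thesis using singleton_add_pair[OF assms] by simp
qed

lemma sum_cluster1_last: "sum c (cluster1 (n - 1)) = c {1}"
proof -
  have "cluster1 (n - 1) = {{n - 1}}" using n_large by (auto simp: cluster1_def)
  moreover have "block_sum c ([] @ (n, {1}) # []) = block_sum c ([] @ (n, {n - 1}) # [])"
    by (rule flip) (use n_large in simp_all)
  ultimately show ?thesis by (simp add: block_sum_def)
qed

text \<open>A cluster consists precisely of the sets on the left of \<open>two_cluster_sum\<close>,
  or of \<open>two_cluster_sum_last\<close> when \<open>m = n - 1\<close> has no upper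
  neighbour.\<close>

lemma sum_cluster2:
  assumes "1 \<le> k" "k + 2 \<le> m" "m < n"
  shows "sum c (cluster2 m k) = c {1, n - 1} + (if k = 1 then c {1, 2, n - 1} else 0)
     + (if m = k + 2 then c {1, 2, n - 1} else 0) + (if k = 1 \<and> m = 3 then c {1, 2, n - 2, n - 1} else 0)"
proof -
  define l where "l = m - k - 1"
  have m: "m = k + l + 1" "1 \<le> l" using assms(2) by (auto simp: l_def)
  show ?thesis
  proof (cases "m + 1 < n")
    case True
    have "cluster2 m k = {{k, m}, {k, k + 1, m}, {k, m, m + 1}, {k, k + 1, m, m + 1}}" (is "_ = ?R")
    proof
      show "cluster2 m k \<subseteq> ?R"
      proof
        fix D assume D: "D \<in> cluster2 m k"
        have "D = {k, m} \<union> (if k + 1 \<in> D then {k + 1} else {}) \<union> (if m + 1 \<in> D then {m + 1} else {})"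
          using D by (auto simp: cluster2_def)
        then show "D \<in> ?R" by (auto split: if_splits)
      qed
    qed (use assms True in \<open>auto simp: cluster2_def\<close>)
    moreover have "{k, m} \<noteq> {k, k + 1, m}" "{k, m} \<noteq> {k, m, m + 1}" "{k, m} \<noteq> {k, k + 1, m, m + 1}"
      "{k, k + 1, m} \<noteq> {k, m, m + 1}" "{k, k + 1, m} \<noteq> {k, k + 1, m, m + 1}"
      "{k, m, m + 1} \<noteq> {k, k + 1, m, m + 1}"
    proof -
      have "k + 1 \<notin> {k, m}" "k + 1 \<notin> {k, m, m + 1}" "m + 1 \<notin> {k, m}" "m + 1 \<notin> {k, k + 1, m}"
        using assms(2) by auto
      then show "{k, m} \<noteq> {k, k + 1, m}" "{k, m} \<noteq> {k, m, m + 1}" "{k, m} \<noteq> {k, k + 1, m, m + 1}"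
        "{k, k + 1, m} \<noteq> {k, m, m + 1}" "{k, k + 1, m} \<noteq> {k, k + 1, m, m + 1}"
        "{k, m, m + 1} \<noteq> {k, k + 1, m, m + 1}" by blast+
    qed
    ultimately have "sum c (cluster2 m k) = c {k, m} + c {k, k + 1, m} + c {k, m, m + 1} + c {k, k + 1, m, m + 1}"
      by simp
    also have "\<dots> = c {1, n - 1} + (if k = 1 then c {1, 2, n - 1} else 0) + (if l = 1 then c {1, n - 2, n - 1} else 0)
        + (if k = 1 \<and> l = 1 then c {1, 2, n - 2, n - 1} else 0)"
      using two_cluster_sum[of k l "n - m - 1"] assms m True by (simp add: ac_simps)
    finally show ?thesis using m unfolding pair_singleton_reverse by auto
  next
    case False
    then have mn: "m + 1 = n" using assms by simp
    have "cluster2 m k = {{k, m}, {k, k + 1, m}}" (is "_ = ?R")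
    proof
      show "cluster2 m k \<subseteq> ?R"
      proof
        fix D assume D: "D \<in> cluster2 m k"
        have "D = {k, m} \<union> (if k + 1 \<in> D then {k + 1} else {})"
          using D mn by (auto simp: cluster2_def)
        then show "D \<in> ?R" by (auto split: if_splits)
      qed
    qed (use assms in \<open>auto simp: cluster2_def\<close>)
    moreover have "{k, m} \<noteq> {k, k + 1, m}"
    proof -
      have "k + 1 \<notin> {k, m}" using assms(2) by auto
      then show ?thesis by blast
    qed
    ultimately have "sum c (cluster2 m k) = c {k, m} + c {k, k + 1, m}"
      by simp
    also have "\<dots> = c {1, n - 1} + (if k = 1 then c {1, 2, n - 1} else 0) + (if l = 1 then c {1, n - 2, n - 1} else 0)"
      using two_cluster_sum_last[of k l] assms m mn by (simp add: ac_simps)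
    finally show ?thesis using m mn n_large unfolding pair_singleton_reverse by auto
  qed
qed

lemma sum_minus_2: "3 \<le> N \<Longrightarrow> 2 * (\<Sum>m\<in>{3..<N}. m - 2) = (N - 2) * (N - 3)" for N :: nat
proof (induction N rule: nat_induct_at_least)
  case (Suc N)
  then obtain t where t: "N = t + 3" by (metis add.commute le_Suc_ex)
  have "(\<Sum>m\<in>{3..<Suc N}. m - 2) = (\<Sum>m\<in>{3..<N}. m - 2) + (N - 2)" using Suc.hyps by simp
  then have "2 * (\<Sum>m\<in>{3..<Suc N}. m - 2) = (N - 2) * (N - 3) + 2 * (N - 2)" using Suc.IH by simp
  then show ?case using t by (simp add: algebra_simps)
qed simp

text \<open>For \<open>5 \<le> j \<le> n - 2\<close> the value \<open>c {1, j}\<close> is constantly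
  \<open>c {1, n - 1} - c {1, 2, n - 1}\<close>. The indices 2, 3, 4 and \<open>n - 1\<close> are
  exceptional, and the first three contribute the alternating sum of initial runs.\<close>

lemma sum_coeff_1j:
  "int (\<Sum>j\<in>{2..<n}. c {1, j}) = int (c {1, 2}) - int (c {1, 2, 3}) + int (c {1, 2, 3, 4})
     + (int n - 3) * int (c {1, n - 1}) - (int n - 6) * int (c {1, 2, n - 1}) - int (c {1, 2, n - 2, n - 1})"
proof -
  let ?\<kappa> = "int (c {1, n - 1})" and ?y = "int (c {1, 2, n - 1})"
  have s: "{2..<n} = {2, 3, 4} \<union> {5..<n - 1} \<union> {n - 1}" using n_large by auto
  have "(\<Sum>j\<in>{2..<n}. int (c {1, j})) = int (c {1, 2}) + int (c {1, 3}) + int (c {1, 4})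
      + (\<Sum>j\<in>{5..<n - 1}. int (c {1, j})) + ?\<kappa>"
    unfolding s using n_large by (subst sum.union_disjoint; simp)+
  also have "(\<Sum>j\<in>{5..<n - 1}. int (c {1, j})) = (\<Sum>j\<in>{5..<n - 1}. ?\<kappa> - ?y)"
  proof (rule sum.cong)
    fix j assume "j \<in> {5..<n - 1}"
    then have "4 \<le> j" "5 \<le> j" "j + 2 \<le> n" by auto
    then show "int (c {1, j}) = ?\<kappa> - ?y" using coeff_1j[of j] coeff_1_pair[of j] by linarith
  qed simp
  also have "\<dots> = (int n - 6) * (?\<kappa> - ?y)" using n_large by (simp add: of_nat_diff)
  finally have eq: "int (\<Sum>j\<in>{2..<n}. c {1, j}) = int (c {1, 2}) + int (c {1, 3}) + int (c {1, 4})
      + (int n - 6) * (?\<kappa> - ?y) + ?\<kappa>" by simp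
  have "c {1, 4} + c {1, 3, 4} = c {1, n - 1}" using coeff_1j[of 4] n_large by simp
  then show ?thesis unfolding eq using coeff_13 coeff_134 by (simp add: algebra_simps)
qed

text \<open>Doubling avoids the division in the triangular number. The value
  \<open>c {1, 2, n - 2, n - 1}\<close> enters once from the cluster with \<open>k = 1\<close>,
  \<open>m = 3\<close> and once negatively from \<open>sum_coeff_1j\<close>, and cancels.\<close>

theorem sum_low_sets_formula:
  "2 * int (sum c low_sets) = 2 * (int n - 1) * int (c {1}) + int n * (int n - 3) * int (c {1, n - 1})
     + 2 * int n * int (c {1, 2, n - 1}) + 2 * (int (c {1, 2}) - int (c {1, 2, 3}) + int (c {1, 2, 3, 4}))"
proof -
  let ?\<kappa> = "c {1, n - 1}" and ?y = "c {1, 2, n - 1}" and ?u = "c {1, 2, n - 2, n - 1}"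
  have s: "{1..<n} = insert (n - 1) {1..<n - 1}" using n_large by auto
  have "(\<Sum>k\<in>{1..<n}. sum c (cluster1 k)) = c {1} + (\<Sum>k\<in>{1..<n - 1}. c {1} + c {1, k + 1})"
  proof -
    have "(\<Sum>k\<in>{1..<n - 1}. sum c (cluster1 k)) = (\<Sum>k\<in>{1..<n - 1}. c {1} + c {1, k + 1})"
      by (intro sum.cong refl sum_cluster1) auto
    then show ?thesis unfolding s using sum_cluster1_last by simp
  qed
  also have "(\<Sum>k\<in>{1..<n - 1}. c {1} + c {1, k + 1}) = (n - 2) * c {1} + (\<Sum>k\<in>{1..<n - 1}. c {1, k + 1})"
    by (simp add: sum.distrib numeral_2_eq_2)
  also have "(\<Sum>k\<in>{1..<n - 1}. c {1, k + 1}) = (\<Sum>j\<in>{2..<n}. c {1, j})"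
    using n_large sum.shift_bounds_nat_ivl[of "\<lambda>j. c {1, j}" 1 1 "n - 1"] by (simp add: numeral_2_eq_2)
  finally have 1: "(\<Sum>k\<in>{1..<n}. sum c (cluster1 k)) = c {1} + ((n - 2) * c {1} + (\<Sum>j\<in>{2..<n}. c {1, j}))" .
  have "(\<Sum>k\<in>{1..m - 2}. sum c (cluster2 m k)) = (m - 2) * ?\<kappa> + 2 * ?y + (if m = 3 then ?u else 0)"
    if m: "m \<in> {3..<n}" for m
  proof -
    have "(\<Sum>k\<in>{1..m - 2}. sum c (cluster2 m k)) = (\<Sum>k\<in>{1..m - 2}. ?\<kappa> + (if k = 1 then ?y else 0)
        + (if k = m - 2 then ?y else 0) + (if k = 1 then (if m = 3 then ?u else 0) else 0))"
      using m by (intro sum.cong) (auto simp: sum_cluster2)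
    also have "\<dots> = (m - 2) * ?\<kappa> + 2 * ?y + (if m = 3 then ?u else 0)"
    proof -
      have "1 \<le> m - 2" using m by auto
      then show ?thesis by (simp add: sum.distrib sum.delta)
    qed
    finally show ?thesis .
  qed
  then have "(\<Sum>m\<in>{3..<n}. \<Sum>k\<in>{1..m - 2}. sum c (cluster2 m k))
      = (\<Sum>m\<in>{3..<n}. (m - 2) * ?\<kappa> + 2 * ?y + (if m = 3 then ?u else 0))" by (rule sum.cong[OF refl])
  also have "\<dots> = (\<Sum>m\<in>{3..<n}. m - 2) * ?\<kappa> + (n - 3) * (2 * ?y) + ?u"
    using n_large by (simp add: sum.distrib sum.delta sum_distrib_right)
  finally have 2: "(\<Sum>m\<in>{3..<n}. \<Sum>k\<in>{1..m - 2}. sum c (cluster2 m k))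
     = (\<Sum>m\<in>{3..<n}. m - 2) * ?\<kappa> + (n - 3) * (2 * ?y) + ?u" .
  have W: "2 * int (\<Sum>m\<in>{3..<n}. m - 2) = (int n - 2) * (int n - 3)"
    using arg_cong[OF sum_minus_2[of n], of int] n_large by (simp add: of_nat_diff del: of_nat_sum)
  have n2: "int (n - 2) = int n - 2" "int (n - 3) = int n - 3" using n_large by auto
  have "2 * int (sum c low_sets) = 2 * (int (c {1}) + (int n - 2) * int (c {1}) + int (\<Sum>j\<in>{2..<n}. c {1, j}))
     + (2 * int (\<Sum>m\<in>{3..<n}. m - 2)) * int ?\<kappa> + 4 * (int n - 3) * int ?y + 2 * int ?u"
    unfolding sum_low_sets 1 2 of_nat_add of_nat_mult n2 by (simp add: algebra_simps del: of_nat_sum)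
  then show ?thesis unfolding W sum_coeff_1j by (simp add: algebra_simps)
qed

text \<open>The last four inequalities are the non-negativity of \<open>c {1, 2, 6}\<close>,
  \<open>c {2, n - 2}\<close>, \<open>c {4, 5}\<close> and \<open>c {4}\<close>, in this order. The
  parameter \<open>s\<close> is an alternating sum of counts, hence bounded only through the last
  two.\<close>

lemma low_sum_parameters:
  obtains c1 \<kappa> y u s :: int where
    "2 * int (sum c low_sets) = 2 * (int n - 1) * c1 + int n * (int n - 3) * \<kappa> + 2 * int n * y + 2 * s"
    "0 \<le> c1" "0 \<le> u" "u \<le> y" "0 \<le> \<kappa> - 2 * y + u" "0 \<le> s + y - u" "0 \<le> c1 - s + \<kappa> - 2 * y + u"
proof
  show "2 * int (sum c low_sets) = 2 * (int n - 1) * int (c {1}) + int n * (int n - 3) * int (c {1, n - 1})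
     + 2 * int n * int (c {1, 2, n - 1}) + 2 * (int (c {1, 2}) - int (c {1, 2, 3}) + int (c {1, 2, 3, 4}))"
    by (rule sum_low_sets_formula)
  show "int (c {1, 2, n - 2, n - 1}) \<le> int (c {1, 2, n - 1})" using coeff_126 by simp
  show "0 \<le> int (c {1, n - 1}) - 2 * int (c {1, 2, n - 1}) + int (c {1, 2, n - 2, n - 1})"
    using inner_doubletons pair_then_singleton singleton_then_pair by linarith
  show "0 \<le> int (c {1, 2}) - int (c {1, 2, 3}) + int (c {1, 2, 3, 4}) + int (c {1, 2, n - 1}) - int (c {1, 2, n - 2, n - 1})"
    using coeff_45 coeff_126 by linarith
  have "c {4} + c {4, 5} = c {1} + c {1, 5}" using singleton_add_pair[of 4] n_large by simp
  moreover have "c {1, 5} + c {1, 2, n - 1} = c {1, n - 1}" using coeff_1j[of 5] coeff_1_pair[of 5] n_large by simp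
  ultimately show "0 \<le> int (c {1}) - (int (c {1, 2}) - int (c {1, 2, 3}) + int (c {1, 2, 3, 4}))
     + int (c {1, n - 1}) - 2 * int (c {1, 2, n - 1}) + int (c {1, 2, n - 2, n - 1})"
    using coeff_45 coeff_126 by linarith
qed simp_all


end

section \<open>Arithmetic of the parameters\<close>

lemma low_sum_size_form:
  fixes n p c1 \<kappa> y u s :: int
  assumes n: "n \<ge> 20" and p: "p < (n - 1) * (n - 3)"
    and eq: "2 * p = 2 * (n - 1) * c1 + n * (n - 3) * \<kappa> + 2 * n * y + 2 * s"
    and h: "0 \<le> c1" "0 \<le> u" "u \<le> y" "0 \<le> \<kappa> - 2 * y + u" "0 \<le> s + y - u" "0 \<le> c1 - s + \<kappa> - 2 * y + u"
  shows "(\<exists>a b. 0 \<le> a \<and> 0 \<le> b \<and> p = a * (n - 1) + b * n)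
       \<or> (\<exists>a b. 0 \<le> a \<and> 0 \<le> b \<and> 2 * p = n * (n - 3) + 2 * (a * (n - 1) + b * n))
       \<or> (\<exists>b. 0 \<le> b \<and> 2 * p = (n - 1) * (n - 2) + 2 * (b * n))"
proof -
  have sq: "2 * p < 2 * ((n - 1) * (n - 3))" using p by simp
  have c1: "0 \<le> (n - 1) * c1" using n h by simp
  have y: "s + n * y \<ge> 0"
  proof -
    have "n * y \<ge> 1 * y" using n h by (intro mult_right_mono) auto
    then show ?thesis using h by linarith
  qed
  \<comment> \<open>Already \<kappa> = 2 contributes n (n - 3), which exceeds (n - 1) (n -
    3).\<close>
  have k: "\<kappa> < 2"
  proof (rule ccontr)
    assume "\<not> \<kappa> < 2"
    then have "n * (n - 3) * 2 \<le> n * (n - 3) * \<kappa>" using n by (intro mult_left_mono) auto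
    moreover have "2 * p \<ge> n * (n - 3) * \<kappa>" using eq c1 y by (simp add: algebra_simps)
    ultimately show False using sq n by (simp add: algebra_simps)
  qed
  have "\<kappa> \<ge> y" using h by linarith
  then consider "\<kappa> = 0" "y = 0" "u = 0" | "\<kappa> = 1" "y = 0" "u = 0" | "\<kappa> = 1" "y = 1" "u = 1"
    using k h by linarith
  then show ?thesis
  proof cases
    case 1
    then have "p = (c1 - s) * (n - 1) + s * n" using eq by (simp add: algebra_simps)
    moreover have "0 \<le> s" "0 \<le> c1 - s" using h 1 by auto
    ultimately show ?thesis by blast
  next
    case 2
    show ?thesis
    proof (cases "s \<le> c1")
      case True
      have "2 * p = n * (n - 3) + 2 * ((c1 - s) * (n - 1) + s * n)" using eq 2 by (simp add: algebra_simps)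
      moreover have "0 \<le> s" "0 \<le> c1 - s" using h 2 True by auto
      ultimately show ?thesis by blast
    next
      case False
      \<comment> \<open>An excess of \<open>s\<close> over \<open>c1\<close> by one turns n (n - 3)
        / 2 into (n - 1) (n - 2) / 2; the dimension of the hook shape arises only here.\<close>
      then have "s = c1 + 1" using h 2 by simp
      then have "2 * p = (n - 1) * (n - 2) + 2 * (c1 * n)" using eq 2 by (simp add: algebra_simps)
      then show ?thesis using h by blast
    qed
  next
    case 3
    then have "2 * p = n * (n - 3) + 2 * ((c1 - s) * (n - 1) + (s + 1) * n)" using eq by (simp add: algebra_simps)
    moreover have "0 \<le> s + 1" "0 \<le> c1 - s" using h 3 by auto
    ultimately show ?thesis by blast
  qed
qed

section \<open>Positive counts force low or co-low descent sets\<close>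

fun cut_word :: "nat \<Rightarrow> nat list \<Rightarrow> nat set \<Rightarrow> block list" where
  "cut_word off [] D = []"
| "cut_word off (k # ks) D = (k, {x \<in> {1..<k}. off + x \<in> D}) # cut_word (off + k) ks D"

lemma map_fst_cut_word [simp]: "map fst (cut_word off ks D) = ks"
  by (induction ks arbitrary: off) auto

lemma valid_cut_word: "\<forall>k\<in>set ks. 0 < k \<Longrightarrow> valid_blocks (cut_word off ks D)"
  by (induction ks arbitrary: off) auto

lemma cut_word_append:
  "cut_word off (ks @ ks') D = cut_word off ks D @ cut_word (off + sum_list ks) ks' D"
  by (induction ks arbitrary: off) (auto simp: add.assoc)

lemma cut_word_replicate_1: "cut_word off (replicate m 1) D = replicate m (1, {})"
  by (induction m arbitrary: off) auto

lemma block_ones_cut_word: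
  assumes "\<forall>k\<in>set ks. 0 < k"
  shows "block_ones off (cut_word off ks D)
    = D \<inter> {off<..<off + sum_list ks} - block_cuts off (cut_word off ks D)"
  using assms
proof (induction ks arbitrary: off)
  case (Cons k ks)
  have hd: "(+) off ` {x \<in> {1..<k}. off + x \<in> D} = D \<inter> {off<..<off + k}"
  proof (intro set_eqI iffI)
    fix x assume "x \<in> D \<inter> {off<..<off + k}"
    then have "x = off + (x - off)" "x - off \<in> {x \<in> {1..<k}. off + x \<in> D}" by auto
    then show "x \<in> (+) off ` {x \<in> {1..<k}. off + x \<in> D}" by blast
  qed auto
  show ?case
  proof (cases ks)
    case Nil
    then show ?thesis using hd by simp
  next
    case (Cons k' ks')
    let ?tl = "cut_word (off + k) ks D"
    have k: "0 < k" "0 < sum_list ks" using Cons.prems Cons by auto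
    have v: "valid_blocks ?tl" using Cons.prems by (intro valid_cut_word) auto
    have gt: "off + k < x" if "x \<in> block_cuts (off + k) ?tl" for x using block_cuts_gt[OF v that] .
    have c: "block_cuts off (cut_word off (k # ks) D) = insert (off + k) (block_cuts (off + k) ?tl)"
      using Cons by simp
    have o: "block_ones off (cut_word off (k # ks) D)
        = D \<inter> {off<..<off + k} \<union> (D \<inter> {off + k<..<off + k + sum_list ks} - block_cuts (off + k) ?tl)"
      using Cons.IH[of "off + k"] Cons.prems hd by simp
    show ?thesis unfolding c o
    proof (intro set_eqI iffI)
      fix x
      assume "x \<in> D \<inter> {off<..<off + sum_list (k # ks)} - insert (off + k) (block_cuts (off + k) ?tl)"
      then show "x \<in> D \<inter> {off<..<off + k} \<union> (D \<inter> {off + k<..<off + k + sum_list ks} - block_cuts (off + k) ?tl)"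
        by (cases x "off + k" rule: linorder_cases) auto
    next
      fix x
      assume "x \<in> D \<inter> {off<..<off + k} \<union> (D \<inter> {off + k<..<off + k + sum_list ks} - block_cuts (off + k) ?tl)"
      then show "x \<in> D \<inter> {off<..<off + sum_list (k # ks)} - insert (off + k) (block_cuts (off + k) ?tl)"
        using k gt by fastforce
    qed
  qed
qed simp

text \<open>\<open>D\<close> matches its own cut word: its descents at cuts are one of the choices
  of free letters.\<close>

lemma block_sum_cut_word_ge:
  assumes "\<forall>k\<in>set ks. 0 < k" "sum_list ks = n" "D \<subseteq> {1..<n}"
  shows "c D \<le> block_sum c (cut_word 0 ks D)"
proof -
  let ?C = "block_cuts 0 (cut_word 0 ks D)" and ?O = "block_ones 0 (cut_word 0 ks D)"
  have "?O = D \<inter> {0<..<n} - ?C" using block_ones_cut_word[OF assms(1), of 0 D] assms(2) by simp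
  then have "D = ?O \<union> (D \<inter> ?C)" using assms(3) by auto
  then have "c D = c (?O \<union> (D \<inter> ?C))" by metis
  also have "\<dots> \<le> (\<Sum>X\<in>Pow ?C. c (?O \<union> X))"
    by (rule member_le_sum[where f = "\<lambda>X. c (?O \<union> X)"]) auto
  finally show ?thesis by (simp add: block_sum_def psum_def)
qed

lemma mset_map_if:
  "mset (map (\<lambda>i. if P i then a else b) [0..<N])
     = replicate_mset (card {i. i < N \<and> P i}) a + replicate_mset (N - card {i. i < N \<and> P i}) b"
proof (induction N)
  case (Suc N)
  have "{i. i < Suc N \<and> P i} = (if P N then insert N {i. i < N \<and> P i} else {i. i < N \<and> P i})"
    by (auto simp: less_Suc_eq)
  moreover have "card {i. i < N \<and> P i} \<le> N"
    using card_mono[of "{..<N}" "{i. i < N \<and> P i}"] by auto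
  ultimately show ?case using Suc by (auto simp: Suc_diff_le)
qed simp

lemma replicate_mset_add: "replicate_mset (a + b) x = replicate_mset a x + replicate_mset b x"
  by (induction a) auto

text \<open>Blocks of length two put all cuts at even positions, so the prescribed letters are those
  at odd positions and each forms a block content of its own. For odd n the last entry is a block
  without letters.\<close>

definition odd_cuts :: "nat \<Rightarrow> nat list" where
  "odd_cuts n = replicate (n div 2) 2 @ (if odd n then [1] else [])"

lemma odd_cuts_pos: "\<forall>k\<in>set (odd_cuts n). 0 < k"
  by (auto simp: odd_cuts_def)

lemma sum_list_odd_cuts: "sum_list (odd_cuts n) = n"
  by (simp add: odd_cuts_def sum_list_replicate) presburger

lemma cut_word_replicate_2:
  "cut_word (2 * m) (replicate N 2) D
     = map (\<lambda>i. if 2 * (m + i) + 1 \<in> D then (2, {1}) else (2, {})) [0..<N]"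
proof (induction N arbitrary: m)
  case (Suc N)
  have s: "[0..<Suc N] = 0 # map Suc [0..<N]" by (simp add: upt_conv_Cons map_Suc_upt del: upt_Suc)
  have "{x. (1::nat) \<le> x \<and> x < 2 \<and> 2 * m + x \<in> D} = (if 2 * m + 1 \<in> D then {1} else {})"
    by (auto simp: le_less_Suc_eq numeral_2_eq_2)
  then show ?case using Suc[of "Suc m"] unfolding s by (simp add: comp_def)
qed simp

lemma mset_cut_word_odd_cuts:
  "mset (cut_word 0 (odd_cuts n) D)
     = replicate_mset (card {i. i < n div 2 \<and> 2 * i + 1 \<in> D}) (2, {1})
     + replicate_mset (n div 2 - card {i. i < n div 2 \<and> 2 * i + 1 \<in> D}) (2, {})
     + (if odd n then {#(1, {})#} else {#})"
proof -
  have "cut_word 0 (odd_cuts n) D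
      = map (\<lambda>i. if 2 * i + 1 \<in> D then (2, {1}) else (2, {})) [0..<n div 2] @ (if odd n then [(1, {})] else [])"
    using cut_word_replicate_2[of 0 "n div 2" D] by (simp add: odd_cuts_def cut_word_append)
  then show ?thesis by (simp only: mset_append mset_map_if) simp
qed

lemma block_cuts_fst: "map fst bs = map fst bs' \<Longrightarrow> block_cuts off bs = block_cuts off bs'"
proof (induction off bs arbitrary: bs' rule: block_cuts.induct)
  case (2 off b)
  then show ?case by (cases bs') auto
next
  case (3 off b b1 bs)
  then obtain b' b1' bs'' where "bs' = b' # b1' # bs''" by (cases bs'; cases "tl bs'") auto
  moreover from this have "block_cuts (off + fst b) (b1 # bs) = block_cuts (off + fst b) (b1' # bs'')"
    using 3 by (intro "3.IH") simp
  ultimately show ?case using 3 by simp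
qed simp

lemma even_block_cuts:
  "\<lbrakk>\<forall>k\<in>set (butlast (map fst bs)). even k; even off; x \<in> block_cuts off bs\<rbrakk> \<Longrightarrow> even x"
  by (induction off bs rule: block_cuts.induct) auto

lemma even_block_cuts_odd_cuts:
  assumes "x \<in> block_cuts 0 (cut_word 0 (odd_cuts n) D)"
  shows "even x"
  by (rule even_block_cuts[OF _ _ assms]) (auto simp: odd_cuts_def butlast_append dest: in_set_butlastD)

locale small_total =
  fixes n :: nat and c :: "nat set \<Rightarrow> nat"
  assumes n_large: "n \<ge> 52"
    and perm_inv: "perm_inv n c"
    and total: "(\<Sum>D\<in>Pow {1..<n}. c D) < (n - 1) * (n - 3)"
begin

text \<open>The letters at odd positions can be rearranged arbitrarily, and different arrangements are matched
  by disjoint families of words.\<close>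
lemma binomial_le_total:
  assumes "D \<subseteq> {1..<n}" "0 < c D"
  shows "(n div 2) choose (card {i. i < n div 2 \<and> 2 * i + 1 \<in> D}) < (n - 1) * (n - 3)"
proof -
  define N where "N = n div 2"
  define j where "j = card {i. i < N \<and> 2 * i + 1 \<in> D}"
  define As where "As = {A. A \<subseteq> {..<N} \<and> card A = j}"
  define w where "w A = (\<lambda>i::nat. 2 * i + 1) ` A" for A
  let ?bs = "\<lambda>D. cut_word 0 (odd_cuts n) D"
  define C where "C = block_cuts 0 (?bs D)"
  have C: "block_cuts 0 (?bs D') = C" for D'
    unfolding C_def by (rule block_cuts_fst) simp
  have evenC: "even x" if "x \<in> C" for x using that even_block_cuts_odd_cuts by (auto simp: C_def)
  have v: "valid_blocks (?bs D')" for D' by (rule valid_cut_word[OF odd_cuts_pos])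
  have C_sub: "C \<subseteq> {1..<n}"
    using block_cuts_gt[OF v] block_cuts_lt[OF v] sum_list_odd_cuts[of n] by (fastforce simp: C_def)
  have w_sub: "w A \<subseteq> {1..<n}" if "A \<in> As" for A
    using that by (force simp: As_def w_def N_def)
  have ones: "block_ones 0 (?bs (w A)) = w A" if "A \<in> As" for A
  proof -
    have "w A \<inter> C = {}" using evenC by (fastforce simp: w_def)
    moreover have "block_ones 0 (?bs (w A)) = w A \<inter> {0<..<n} - C"
      using block_ones_cut_word[OF odd_cuts_pos, of 0 n "w A"] by (simp add: sum_list_odd_cuts C)
    ultimately show ?thesis using w_sub[OF that] by auto
  qed
  have ge: "1 \<le> (\<Sum>X\<in>Pow C. c (w A \<union> X))" if A: "A \<in> As" for A
  proof -
    have "{i. i < N \<and> 2 * i + 1 \<in> w A} = A" using A by (auto simp: As_def w_def)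
    then have "mset (?bs D) = mset (?bs (w A))"
      unfolding mset_cut_word_odd_cuts using A by (simp add: As_def N_def[symmetric] j_def)
    then have "block_sum c (?bs D) = block_sum c (?bs (w A))"
      by (intro perm_invD[OF perm_inv] v) (simp_all add: sum_list_odd_cuts)
    moreover have "1 \<le> block_sum c (?bs D)"
      using block_sum_cut_word_ge[OF odd_cuts_pos sum_list_odd_cuts assms(1), of c] assms(2) by linarith
    ultimately show ?thesis by (simp add: block_sum_def psum_def C ones[OF A])
  qed
  have finAs: "finite As" by (rule finite_subset[of _ "Pow {..<N}"]) (auto simp: As_def)
  have finC: "finite C" by (simp add: C_def)
  \<comment> \<open>Parity recovers both components: prescribed descents are odd, cuts are
    even.\<close>
  have inj: "inj_on (\<lambda>(A, X). w A \<union> X) (As \<times> Pow C)"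
  proof (rule inj_onI, clarify)
    fix A X A' X' assume *: "w A \<union> X = w A' \<union> X'" "X \<subseteq> C" "X' \<subseteq> C"
    have odd: "odd x" if "x \<in> w B" for x B using that by (auto simp: w_def)
    have "w A = {x \<in> w A \<union> X. odd x}" "w A' = {x \<in> w A' \<union> X'. odd x}"
      "X = {x \<in> w A \<union> X. even x}" "X' = {x \<in> w A' \<union> X'. even x}"
      using *(2,3) odd evenC by auto
    then have "w A = w A'" "X = X'" unfolding *(1) by metis+
    moreover have "inj (\<lambda>i::nat. 2 * i + 1)" by (auto simp: inj_on_def)
    ultimately show "A = A' \<and> X = X'" unfolding w_def by (simp add: inj_image_eq_iff)
  qed
  have "N choose j = card As" unfolding As_def by (simp add: n_subsets)
  also have "\<dots> \<le> (\<Sum>A\<in>As. \<Sum>X\<in>Pow C. c (w A \<union> X))"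
    using sum_mono[of As "\<lambda>_. 1" "\<lambda>A. \<Sum>X\<in>Pow C. c (w A \<union> X)"] ge by simp
  also have "\<dots> = (\<Sum>(A, X)\<in>As \<times> Pow C. c (w A \<union> X))"
    by (rule sum.cartesian_product)
  also have "\<dots> = (\<Sum>D\<in>(\<lambda>(A, X). w A \<union> X) ` (As \<times> Pow C). c D)"
    by (subst sum.reindex[OF inj]) (simp add: case_prod_unfold)
  also have "\<dots> \<le> (\<Sum>D\<in>Pow {1..<n}. c D)"
    using w_sub C_sub by (intro sum_mono2) auto
  finally show ?thesis using total by (simp add: N_def j_def)
qed

text \<open>Here the constant 52 originates. With N = n div 2 one has (n - 1) (n - 3) \<le> 4 N (N -
  1), while N choose 3 is N (N - 1) (N - 2) / 6; the comparison works as soon as N - 2 \<ge> 24.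
  Other values of \<open>j\<close> reduce to 3 by unimodality and symmetry of the binomial
  coefficients.\<close>

lemma choose_bound:
  assumes "3 \<le> j" "j + 3 \<le> n div 2"
  shows "(n - 1) * (n - 3) \<le> (n div 2) choose j"
proof -
  define N where "N = n div 2"
  have N: "26 \<le> N" "n \<le> 2 * N + 1" using n_large by (auto simp: N_def)
  have 1: "(N choose 3) \<le> (N choose j)" if "j \<le> N div 2" "3 \<le> j" for j
    using that by (intro binomial_mono) auto
  have "(N choose 3) \<le> (N choose j)"
  proof (cases "j \<le> N div 2")
    case False
    have "(N choose (N - j)) = (N choose j)" using assms by (intro binomial_symmetric[symmetric]) (auto simp: N_def)
    moreover have "N - j \<le> N div 2" "3 \<le> N - j" using False assms by (auto simp: N_def)
    ultimately show ?thesis using 1[of "N - j"] by simp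
  qed (use 1 assms in auto)
  moreover have "(n - 1) * (n - 3) \<le> (N choose 3)"
  proof -
    obtain t where t: "N = t + 26" using N(1) le_Suc_ex by (metis add.commute)
    have "(n - 1) * (n - 3) \<le> (2 * N) * (2 * N - 2)" using N by (intro mult_mono) auto
    also have "\<dots> = 4 * ((t + 26) * (t + 25))" using t by (simp add: algebra_simps)
    finally have a: "6 * ((n - 1) * (n - 3)) \<le> 24 * ((t + 26) * (t + 25))" by simp
    have "3 * (N choose 3) = (t + 26) * ((t + 25) choose 2)"
      using Suc_times_binomial[of 2 "t + 25"] t by (simp add: numeral_3_eq_3 add.commute)
    moreover have "2 * ((t + 25) choose 2) = (t + 25) * (t + 24)"
      using Suc_times_binomial[of 1 "t + 24"] by (simp add: numeral_2_eq_2 add.commute)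
    moreover have "6 * (N choose 3) = 2 * (3 * (N choose 3))" by simp
    ultimately have "6 * (N choose 3) = (t + 26) * ((t + 25) * (t + 24))" by (metis mult.left_commute)
    then have "6 * (N choose 3) = (t + 24) * ((t + 26) * (t + 25))" by (simp only: mult_ac)
    moreover have "24 * ((t + 26) * (t + 25)) \<le> (t + 24) * ((t + 26) * (t + 25))"
      by (intro mult_right_mono) auto
    ultimately show ?thesis using a by linarith
  qed
  ultimately show ?thesis by (simp add: N_def)
qed

text \<open>Each chosen position becomes the only letter of a block of length two, and every other
  entry is a block by itself. The multiset of blocks then remembers no more than how many chosen
  positions lie in \<open>D\<close>. Distance two keeps the long blocks disjoint.\<close>

lemma isolating_blocks:
  assumes "sorted_wrt (\<lambda>a b. a + 2 \<le> b) ps" "\<forall>p\<in>set ps. off < p \<and> p < n" "off \<le> n"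
  shows "\<exists>ks. (\<forall>k\<in>set ks. 0 < k) \<and> sum_list ks = n - off \<and> 2 * length ps \<le> n - off \<and>
     mset (cut_word off ks D) = mset (map (\<lambda>p. (2, if p \<in> D then {1} else {})) ps)
       + replicate_mset (n - off - 2 * length ps) (1, {})"
  using assms
proof (induction ps arbitrary: off)
  case Nil
  show ?case
    by (rule exI[of _ "replicate (n - off) 1"]) (auto simp: cut_word_replicate_1[unfolded One_nat_def] sum_list_replicate)
next
  case (Cons p ps)
  have p: "off < p" "p < n" using Cons.prems by auto
  obtain ks where ks: "\<forall>k\<in>set ks. 0 < k" "sum_list ks = n - (p + 1)" "2 * length ps \<le> n - (p + 1)"
    "mset (cut_word (p + 1) ks D) = mset (map (\<lambda>p. (2, if p \<in> D then {1} else {})) ps)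
       + replicate_mset (n - (p + 1) - 2 * length ps) (1, {})"
    using Cons.IH[of "p + 1"] Cons.prems by (auto simp: Suc_le_eq)
  have two: "{x. (1::nat) \<le> x \<and> x < 2 \<and> p - 1 + x \<in> D} = (if p \<in> D then {1} else {})"
    using p by (auto simp: le_less_Suc_eq numeral_2_eq_2)
  \<comment> \<open>The block covering the entries \<open>p\<close> and \<open>p + 1\<close> starts
    at offset \<open>p - 1\<close>, so \<open>p - 1 - off\<close> unit blocks precede it; the
    remaining positions all exceed \<open>p + 1\<close>.\<close>
  have "cut_word off (replicate (p - 1 - off) 1 @ 2 # ks) D
      = replicate (p - 1 - off) (1, {}) @ (2, if p \<in> D then {1} else {}) # cut_word (p + 1) ks D"
    using p two by (simp add: cut_word_append cut_word_replicate_1[unfolded One_nat_def] sum_list_replicate)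
  moreover have "n - off - 2 * length (p # ps) = (p - 1 - off) + (n - (p + 1) - 2 * length ps)"
    using p ks(3) by simp
  ultimately have "mset (cut_word off (replicate (p - 1 - off) 1 @ 2 # ks) D)
      = mset (map (\<lambda>p. (2, if p \<in> D then {1} else {})) (p # ps)) + replicate_mset (n - off - 2 * length (p # ps)) (1, {})"
    using ks(4) by (simp only: mset_append mset.simps mset_replicate replicate_mset_add list.map) simp
  moreover have "sum_list (replicate (p - 1 - off) 1 @ 2 # ks) = n - off" "2 * length (p # ps) \<le> n - off"
    using p ks(2,3) by (simp_all add: sum_list_replicate)
  ultimately show ?case
    using ks(1) by (intro exI[of _ "replicate (p - 1 - off) 1 @ 2 # ks"]) auto
qed


text \<open>Six isolated letters can be moved to the positions \<open>1, 3, \<dots>, 11\<close>, so that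
  \<open>binomial_le_total\<close> applies to another set with positive count.\<close>
lemma six_positions:
  assumes D: "D \<subseteq> {1..<n}" "0 < c D"
    and A: "A \<subseteq> D" "card A = 3" and B: "B \<subseteq> {1..<n} - D" "card B = 3"
    and far: "\<And>x y. \<lbrakk>x \<in> A \<union> B; y \<in> A \<union> B; x < y\<rbrakk> \<Longrightarrow> x + 2 \<le> y"
  shows False
proof -
  have fin: "finite A" "finite B" using A B by (auto intro: card_ge_0_finite)
  define ps where "ps = sorted_list_of_set (A \<union> B)"
  have set_ps: "set ps = A \<union> B" using fin by (simp add: ps_def)
  have mset_ps: "mset ps = mset_set A + mset_set B"
  proof -
    have "A \<inter> B = {}" using A B by auto
    then have "mset_set (A \<union> B) = mset_set A + mset_set B" using fin by (simp add: mset_set_Union)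
    moreover have "mset_set (set ps) = mset ps" by (rule mset_set_set) (simp add: ps_def)
    ultimately show ?thesis unfolding set_ps by simp
  qed
  have "sorted_wrt (\<lambda>a b. a + 2 \<le> b) ps"
    by (rule sorted_wrt_mono_rel[OF _ strict_sorted_list_of_set[of "A \<union> B", folded ps_def]])
      (use far set_ps in auto)
  moreover have "\<forall>p\<in>set ps. 0 < p \<and> p < n" using set_ps A B D by fastforce
  ultimately obtain ks where ks: "\<forall>k\<in>set ks. 0 < k" "sum_list ks = n"
    "mset (cut_word 0 ks D) = mset (map (\<lambda>p. (2, if p \<in> D then {1} else {})) ps)
       + replicate_mset (n - 2 * length ps) (1, {})"
    using isolating_blocks[of ps 0 D] by auto
  have "image_mset (\<lambda>p. (2::nat, if p \<in> D then {1} else {}::nat set)) (mset_set A) = image_mset (\<lambda>_. (2, {1})) (mset_set A)"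
    using A fin by (intro image_mset_cong) auto
  moreover have "image_mset (\<lambda>p. (2::nat, if p \<in> D then {1} else {}::nat set)) (mset_set B) = image_mset (\<lambda>_. (2, {})) (mset_set B)"
    using B fin by (intro image_mset_cong) auto
  ultimately have m6: "mset (map (\<lambda>p. (2::nat, if p \<in> D then {1} else {}::nat set)) ps)
      = replicate_mset 3 (2, {1}) + replicate_mset 3 (2, {})"
    using A B by (simp add: mset_ps image_mset_const_eq)
  have "length ps = 6"
    using arg_cong[OF mset_ps, of size] A B by simp
  moreover obtain t where n: "n = t + 52" using n_large le_Suc_ex by (metis add.commute)
  \<comment> \<open>Six blocks of length two use twelve entries and leave
    \<open>n - 12 = t + 40\<close> unit blocks.\<close>
  ultimately have m: "mset (cut_word 0 ks D) = replicate_mset 3 (2, {1}) + replicate_mset 3 (2, {}) + replicate_mset (t + 40) (1, {})"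
    using ks(3) m6 by (simp add: add.commute)
  define bs :: "block list" where "bs = [(2, {1}), (2, {1}), (2, {1}), (2, {}), (2, {}), (2, {})] @ replicate (t + 40) (1, {})"
  have "mset bs = mset (cut_word 0 ks D)" unfolding m by (simp add: bs_def numeral_3_eq_3 add_ac)
  moreover have v: "valid_blocks bs" by (simp add: bs_def valid_blocks_def)
  ultimately have "block_sum c bs = block_sum c (cut_word 0 ks D)"
    using n by (intro perm_invD[OF perm_inv]) (simp_all add: bs_def sum_list_replicate)
  moreover have "c D \<le> block_sum c (cut_word 0 ks D)"
    by (rule block_sum_cut_word_ge[OF ks(1,2) D(1)])
  ultimately have "0 < block_sum c bs" using D(2) by linarith
  then obtain X where X: "X \<subseteq> block_cuts 0 bs" "0 < c (block_ones 0 bs \<union> X)"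
    unfolding block_sum_def psum_def by (metis (no_types, lifting) PowD bot_nat_0.not_eq_extremum sum.neutral)
  define D' where "D' = block_ones 0 bs \<union> X"
  have tl: "block_ones off (replicate m (1, {})) = {}" for off m
    by (induction m arbitrary: off) auto
  have ones: "block_ones 0 bs = {1, 3, 5}" by (simp add: bs_def tl[unfolded One_nat_def] numeral_eq_Suc insert_commute)
  have cuts: "x \<notin> block_cuts 0 bs" if "x \<in> {7, 9, 11}" for x
  proof -
    define rest :: "block list" where "rest = replicate (t + 39) (1, {})"
    have r: "replicate (t + 40) (1, {}) = (1, {}) # rest" by (simp add: rest_def numeral_eq_Suc)
    have "block_cuts 0 bs = {2, 4, 6, 8, 10} \<union> insert 12 (block_cuts 12 ((1, {}) # rest))"
      unfolding bs_def r by (simp add: numeral_eq_Suc insert_commute)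
    moreover have "12 < y" if "y \<in> block_cuts 12 ((1, {}) # rest)" for y
      by (rule block_cuts_gt[OF _ that]) (simp add: valid_blocks_def rest_def)
    ultimately show ?thesis using that by fastforce
  qed
  have size: "blocks_size bs = n" using n by (simp add: bs_def sum_list_replicate)
  have D'_sub: "D' \<subseteq> {1..<n}"
  proof
    fix x assume "x \<in> D'"
    then consider "x \<in> {1, 3, 5}" | "x \<in> block_cuts 0 bs" using X(1) by (auto simp: D'_def ones)
    then show "x \<in> {1..<n}"
    proof cases
      case 2
      show ?thesis using block_cuts_gt[OF v 2] block_cuts_lt[OF v 2] size by simp
    qed (use n in auto)
  qed
  \<comment> \<open>The odd positions 1, 3, 5 are descents of \<open>D'\<close> and 7, 9, 11 are
    not, so the number of descents at odd positions is at least 3 and at most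
    \<open>n div 2 - 3\<close>, as \<open>choose_bound\<close> demands.\<close>
  have sub1: "{0, 1, 2} \<subseteq> {i. i < n div 2 \<and> 2 * i + 1 \<in> D'}"
    using n_large by (auto simp: D'_def ones)
  have "7 \<notin> D'" "9 \<notin> D'" "11 \<notin> D'" using cuts X by (auto simp: D'_def ones)
  then have sub2: "{i. i < n div 2 \<and> 2 * i + 1 \<in> D'} \<subseteq> {..<n div 2} - {3, 4, 5}" by auto
  have "3 \<le> card {i. i < n div 2 \<and> 2 * i + 1 \<in> D'}"
    using card_mono[OF _ sub1] by simp
  moreover have "card {i. i < n div 2 \<and> 2 * i + 1 \<in> D'} + 3 \<le> n div 2"
  proof -
    have "{3, 4, 5} \<subseteq> {..<n div 2}" using n_large by auto
    then have "card ({..<n div 2} - {3, 4, 5}) = n div 2 - 3" by (simp add: card_Diff_subset)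
    then show ?thesis using card_mono[OF _ sub2] n_large by simp
  qed
  ultimately have "(n - 1) * (n - 3) \<le> (n div 2) choose card {i. i < n div 2 \<and> 2 * i + 1 \<in> D'}"
    by (rule choose_bound)
  then show False using binomial_le_total[OF D'_sub] X by (simp add: D'_def)
qed

end

section \<open>Separated triples of descents and ascents\<close>

lemma sep3_of_card:
  fixes X :: "nat set"
  assumes "finite X" "5 \<le> card X"
  obtains a b d where "a \<in> X" "b \<in> X" "d \<in> X" "a + 2 \<le> b" "b + 2 \<le> d"
proof -
  define xs where "xs = sorted_list_of_set X"
  have len: "5 \<le> length xs" using assms by (simp add: xs_def)
  have lt: "xs ! i < xs ! Suc i" if "i < 4" for i
    using sorted_wrt_nth_less[OF strict_sorted_list_of_set[of X], of i "Suc i"] that len by (simp add: xs_def)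
  have mem: "xs ! i \<in> X" if "i < 5" for i
    using nth_mem[of i xs] that len assms(1) by (auto simp: xs_def)
  show ?thesis
    using that[of "xs ! 0" "xs ! 2" "xs ! 4"] mem lt[of 0] lt[of 1] lt[of 2] lt[of 3]
    by (simp add: numeral_eq_Suc)
qed

definition nbhd :: "nat set \<Rightarrow> nat set" where
  "nbhd X = (\<Union>x\<in>X. {x - 1, x, x + 1})"

lemma card_nbhd: "finite X \<Longrightarrow> card (nbhd X) \<le> 3 * card X"
proof -
  assume "finite X"
  then have "card (nbhd X) \<le> (\<Sum>x\<in>X. card {x - 1, x, x + 1})"
    unfolding nbhd_def by (rule card_UN_le)
  also have "\<dots> \<le> (\<Sum>x\<in>X. 3)"
    by (intro sum_mono) (auto simp: card_insert_if)
  finally show ?thesis by simp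
qed

lemma finite_nbhd: "finite X \<Longrightarrow> finite (nbhd X)"
  by (simp add: nbhd_def)

lemma far_from_nbhd: "x \<in> X \<Longrightarrow> y \<notin> nbhd X \<Longrightarrow> x + 2 \<le> y \<or> y + 2 \<le> x"
  by (force simp: nbhd_def)

context small_total
begin

text \<open>A descent triple and an ascent triple contradict \<open>six_positions\<close> once they
  are far from each other, and a triple spoils at most nine positions. If five ascents remain away
  from the given descent triple, they contain a suitable triple. Otherwise descents abound there: at
  least 38 of the at least 42 positions; so any ascent triple is taken and the descent triple is
  chosen anew, away from it.\<close>

lemma sep3_almost_full:
  assumes D: "D \<subseteq> {1..<n}" "0 < c D" and sep: "has_sep3 D"
  shows "card ({1..<n} - D) \<le> 4"
proof (rule ccontr)
  assume "\<not> ?thesis"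
  then have Z: "5 \<le> card ({1..<n} - D)" by simp
  have comb: False
    if "A \<subseteq> D" "B \<subseteq> {1..<n} - D" and A: "A = {a, b, d}" "a + 2 \<le> b" "b + 2 \<le> d"
      and B: "B = {a', b', d'}" "a' + 2 \<le> b'" "b' + 2 \<le> d'"
      and AB: "A \<inter> nbhd B = {} \<or> B \<inter> nbhd A = {}" for A B a b d a' b' d'
  proof (rule six_positions[OF D \<open>A \<subseteq> D\<close> _ \<open>B \<subseteq> {1..<n} - D\<close>])
    show "card A = 3" "card B = 3" using A B by auto
    have AB2: "x + 2 \<le> y \<or> y + 2 \<le> x" if "x \<in> A" "y \<in> B" for x y
      using AB far_from_nbhd[of x A y] far_from_nbhd[of y B x] that by blast
    fix x y assume "x \<in> A \<union> B" "y \<in> A \<union> B" "x < y"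
    then consider "x \<in> A" "y \<in> A" | "x \<in> B" "y \<in> B" | "x \<in> A" "y \<in> B" | "x \<in> B" "y \<in> A" by blast
    then show "x + 2 \<le> y"
    proof cases
      case 3 then show ?thesis using AB2[of x y] \<open>x < y\<close> by auto
    next
      case 4 then show ?thesis using AB2[of y x] \<open>x < y\<close> by auto
    qed (use A B \<open>x < y\<close> in auto)
  qed
  obtain a b d where abd: "a \<in> D" "b \<in> D" "d \<in> D" "a + 2 \<le> b" "b + 2 \<le> d"
    using sep by (auto simp: has_sep3_def)
  define R where "R = {1..<n} - nbhd {a, b, d}"
  have "card (nbhd {a, b, d}) \<le> 9" using card_nbhd[of "{a, b, d}"] abd by (simp add: card_insert_if)
  then have R: "42 \<le> card R"
    using diff_card_le_card_Diff[OF finite_nbhd[of "{a, b, d}"], of "{1..<n}"] n_large by (simp add: R_def)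
  have "finite R" by (simp add: R_def)
  show False
  proof (cases "5 \<le> card (R - D)")
    case True
    then obtain a' b' d' where *: "a' \<in> R - D" "b' \<in> R - D" "d' \<in> R - D" "a' + 2 \<le> b'" "b' + 2 \<le> d'"
      using sep3_of_card \<open>finite R\<close> by (metis finite_Diff)
    show False
      by (rule comb[of "{a, b, d}" "{a', b', d'}", OF _ _ refl abd(4,5) refl *(4,5)])
        (use abd * in \<open>auto simp: R_def\<close>)
  next
    case False
    obtain a' b' d' where *: "a' \<in> {1..<n} - D" "b' \<in> {1..<n} - D" "d' \<in> {1..<n} - D" "a' + 2 \<le> b'" "b' + 2 \<le> d'"
      using sep3_of_card[OF _ Z] by blast
    have "card (R - (R - D)) \<ge> 38"
      using diff_card_le_card_Diff[of "R - D" R] \<open>finite R\<close> R False by simp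
    moreover have "card (nbhd {a', b', d'}) \<le> 9" using card_nbhd[of "{a', b', d'}"] * by (simp add: card_insert_if)
    ultimately have "5 \<le> card ((R - (R - D)) - nbhd {a', b', d'})"
      using diff_card_le_card_Diff[OF finite_nbhd[of "{a', b', d'}"], of "R - (R - D)"] by simp
    then obtain x y z where **: "x \<in> (R - (R - D)) - nbhd {a', b', d'}" "y \<in> (R - (R - D)) - nbhd {a', b', d'}"
        "z \<in> (R - (R - D)) - nbhd {a', b', d'}" "x + 2 \<le> y" "y + 2 \<le> z"
      using sep3_of_card \<open>finite R\<close> by (metis finite_Diff)
    show False
      by (rule comb[of "{x, y, z}" "{a', b', d'}", OF _ _ refl **(4,5) refl *(4,5)])
        (use ** * in auto)
  qed
qed

end

section \<open>Symmetric sets and block invariance\<close>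

definition strict_cuts :: "nat list \<Rightarrow> nat set" where
  "strict_cuts xs = {j \<in> {1..<length xs}. xs ! (j - 1) < xs ! j}"

text \<open>A monomial has only one weakly increasing index sequence, so a coefficient is 0 or 1 and
  depends on where that sequence increases strictly.\<close>

lemma F_coeff_sorted:
  assumes "sorted xs" "length xs = n" "D \<subseteq> {1..<n}" "\<And>k. alpha k = count (mset xs) k"
  shows "F_coeff n D alpha = (if D \<subseteq> strict_cuts xs then 1 else 0)"
proof -
  define P where "P = (\<lambda>is :: nat list. length is = n \<and>
      (\<forall>j. 1 \<le> j \<and> j < n \<longrightarrow> is ! (j-1) \<le> is ! j \<and> (j \<in> D \<longrightarrow> is ! (j-1) < is ! j)) \<and>
      (\<forall>k. count (mset is) k = alpha k))"
  have uniq: "ys = xs" if "P ys" for ys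
  proof -
    have "sorted ys" unfolding sorted_iff_nth_Suc
    proof (intro allI impI)
      fix i assume "Suc i < length ys"
      then show "ys ! i \<le> ys ! Suc i" using that by (auto simp: P_def dest!: spec[of _ "Suc i"])
    qed
    moreover have "mset ys = mset xs" using that assms(4) unfolding P_def by (intro multiset_eqI) simp
    ultimately show ?thesis using assms(1) by (metis properties_for_sort)
  qed
  have "P xs \<longleftrightarrow> D \<subseteq> strict_cuts xs"
  proof
    assume "D \<subseteq> strict_cuts xs"
    moreover have "xs ! (j - 1) \<le> xs ! j" if "1 \<le> j" "j < n" for j
      using that assms(1,2) by (intro sorted_nth_mono) auto
    ultimately show "P xs" using assms(2,4) by (auto simp: strict_cuts_def P_def)
  qed (use assms(2,3) in \<open>auto simp: strict_cuts_def P_def\<close>)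
  then have "Collect P = (if D \<subseteq> strict_cuts xs then {xs} else {})" using uniq by auto
  then show ?thesis unfolding F_coeff_def P_def by (simp only: card.empty card.insert) simp
qed

lemma F_coeff_eq_0:
  assumes "\<nexists>xs. length xs = n \<and> (\<forall>k. count (mset xs) k = alpha k)"
  shows "F_coeff n D alpha = 0"
proof -
  have "{is :: nat list. length is = n \<and>
      (\<forall>j. 1 \<le> j \<and> j < n \<longrightarrow> is ! (j-1) \<le> is ! j \<and> (j \<in> D \<longrightarrow> is ! (j-1) < is ! j)) \<and>
      (\<forall>k. count (mset is) k = alpha k)} = {}" using assms by blast
  then show ?thesis unfolding F_coeff_def by (simp only: card.empty)
qed

definition des_count :: "nat \<Rightarrow> (nat \<Rightarrow> nat) set \<Rightarrow> nat set \<Rightarrow> nat" where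
  "des_count n S D = card {w \<in> S. Des n w = D}"

lemma Des_subset: "Des n w \<subseteq> {1..<n}"
  by (auto simp: Des_def)

lemma finite_Sym [simp]: "finite (Sym n)"
  by (simp add: Sym_def finite_permutations)

lemma Q_coeff_card:
  assumes "finite S" "sorted xs" "length xs = n" "\<And>k. alpha k = count (mset xs) k"
  shows "Q_coeff n S alpha = card {w \<in> S. Des n w \<subseteq> strict_cuts xs}"
proof -
  have "Q_coeff n S alpha = (\<Sum>w\<in>S. if Des n w \<subseteq> strict_cuts xs then 1 else 0)"
    unfolding Q_coeff_def by (intro sum.cong refl F_coeff_sorted[OF assms(2,3) Des_subset assms(4)])
  also have "\<dots> = (\<Sum>w\<in>{w \<in> S. Des n w \<subseteq> strict_cuts xs}. 1)"
    by (rule sum.inter_filter[OF assms(1), symmetric])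
  finally show ?thesis by simp
qed

lemma Q_coeff_sorted:
  assumes "finite S" "sorted xs" "length xs = n" "\<And>k. alpha k = count (mset xs) k"
  shows "Q_coeff n S alpha = (\<Sum>D\<in>Pow (strict_cuts xs). des_count n S D)"
proof -
  have "Q_coeff n S alpha = (\<Sum>w\<in>{w \<in> S. Des n w \<subseteq> strict_cuts xs}. 1)"
    using Q_coeff_card[OF assms] by simp
  also have "\<dots> = (\<Sum>D\<in>Pow (strict_cuts xs). \<Sum>w\<in>{w \<in> {w \<in> S. Des n w \<subseteq> strict_cuts xs}. Des n w = D}. 1)"
    using assms(1) by (intro sum.group[symmetric]) (auto simp: strict_cuts_def)
  also have "\<dots> = (\<Sum>D\<in>Pow (strict_cuts xs). des_count n S D)"
    by (intro sum.cong) (auto simp: des_count_def intro!: arg_cong[where f = card])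
  finally show ?thesis .
qed

section \<open>Monomials attached to compositions\<close>

fun comp_word :: "nat \<Rightarrow> nat list \<Rightarrow> nat list" where
  "comp_word l [] = []"
| "comp_word l (k # ks) = replicate k l @ comp_word (Suc l) ks"

lemma length_comp_word [simp]: "length (comp_word l ks) = sum_list ks"
  by (induction ks arbitrary: l) auto

lemma set_comp_word: "x \<in> set (comp_word l ks) \<Longrightarrow> l \<le> x"
  by (induction ks arbitrary: l) fastforce+

lemma sorted_comp_word: "sorted (comp_word l ks)"
  by (induction ks arbitrary: l) (auto simp: sorted_append dest: set_comp_word)

lemma count_comp_word:
  "count (mset (comp_word l ks)) x = (if l \<le> x \<and> x < l + length ks then ks ! (x - l) else 0)"
proof (induction ks arbitrary: l)
  case (Cons k ks)
  then show ?case by (cases "x = l") (auto simp: nth_Cons')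
qed simp

lemma comp_word_strict_iff:
  assumes "\<forall>k\<in>set ks. 0 < k" "1 \<le> j" "j < sum_list ks"
  shows "comp_word l ks ! (j - 1) < comp_word l ks ! j \<longleftrightarrow> off + j \<in> block_cuts off (map (\<lambda>k. (k, {})) ks)"
  using assms
proof (induction ks arbitrary: l off j)
  case (Cons k ks)
  show ?case
  proof (cases ks)
    case Nil
    then show ?thesis using Cons.prems by simp
  next
    case (Cons k' ks')
    let ?tl = "block_cuts (off + k) (map (\<lambda>k. (k, {})) ks)"
    have v: "valid_blocks (map (\<lambda>k. (k, {})) ks)" using Cons.prems by (auto simp: valid_blocks_def)
    have gt: "off + k < x" if "x \<in> ?tl" for x using block_cuts_gt[OF v that] .
    have c: "block_cuts off (map (\<lambda>k. (k, {})) (k # ks)) = insert (off + k) ?tl"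
      using Cons by simp
    consider "j < k" | "j = k" | "k < j" by linarith
    then show ?thesis
    proof cases
      case 1
      moreover from 1 have "off + j \<notin> ?tl" using gt[of "off + j"] by auto
      ultimately show ?thesis using Cons.prems(2) unfolding c by (auto simp: nth_append)
    next
      case 2
      have "0 < k'" using Cons.prems Cons by simp
      then have "comp_word (Suc l) ks ! 0 = Suc l" using Cons by (simp add: nth_append)
      then show ?thesis using 2 Cons.prems(2) unfolding c by (auto simp: nth_append)
    next
      case 3
      have "comp_word (Suc l) ks ! (j - k - 1) < comp_word (Suc l) ks ! (j - k) \<longleftrightarrow> off + k + (j - k) \<in> ?tl"
        using Cons.prems 3 by (intro Cons.IH) auto
      then show ?thesis using 3 Cons.prems(2) unfolding c by (auto simp: nth_append diff_commute)
    qed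
  qed
qed simp

lemma strict_cuts_comp_word:
  assumes "\<forall>k\<in>set ks. 0 < k"
  shows "strict_cuts (comp_word 0 ks) = block_cuts 0 (map (\<lambda>k. (k, {})) ks)"
proof -
  have v: "valid_blocks (map (\<lambda>k. (k, {})) ks)" using assms by (auto simp: valid_blocks_def)
  have "1 \<le> j" "j < sum_list ks" if "j \<in> block_cuts 0 (map (\<lambda>k. (k, {})) ks)" for j
    using block_cuts_gt[OF v that] block_cuts_lt[OF v that] by (simp_all add: comp_def)
  then show ?thesis
    using comp_word_strict_iff[OF assms, of _ 0 0] by (auto simp: strict_cuts_def)
qed

lemma block_ones_empty: "block_ones off (map (\<lambda>k. (k, {})) ks) = {}"
  by (induction ks arbitrary: off) auto

text \<open>For blocks without descents, the block sum is the coefficient of Q(S) at the monomial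
  whose exponents are the block lengths. The permutation matching two orders of the lengths fixes
  all larger indices, so it is a bijection of all variables.\<close>

lemma perm_inv_des_count:
  assumes S: "S \<subseteq> Sym n" "symmetric_set n S"
  shows "perm_inv n (des_count n S)"
proof (rule perm_inv_from_empty_blocks)
  fix ks ks' :: "nat list"
  assume ks: "\<forall>k\<in>set ks. 0 < k" "sum_list ks = n" "mset ks = mset ks'"
  have finS: "finite S" by (rule finite_subset[OF S(1) finite_Sym])
  have ks': "\<forall>k\<in>set ks'. 0 < k" "sum_list ks' = n"
    using ks by (metis mset_eq_setD, metis sum_mset_sum_list)
  define alpha where "alpha ks = count (mset (comp_word 0 ks))" for ks
  have sum: "block_sum (des_count n S) (map (\<lambda>k. (k, {})) ks) = Q_coeff n S (alpha ks)"
    if "\<forall>k\<in>set ks. 0 < k" "sum_list ks = n" for ks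
    using Q_coeff_sorted[OF finS sorted_comp_word[of 0 ks], of n "alpha ks"] strict_cuts_comp_word[OF that(1)] that(2)
    by (simp add: block_sum_def psum_def block_ones_empty alpha_def)
  obtain p where p: "p permutes {..<length ks'}" "permute_list p ks' = ks"
    using mset_eq_permutation[OF ks(3)] .
  have "alpha ks = alpha ks' \<circ> p"
  proof
    fix i
    have len: "length ks = length ks'" using ks(3) mset_eq_length by blast
    show "alpha ks i = (alpha ks' \<circ> p) i"
    proof (cases "i < length ks'")
      case True
      then have "p i < length ks'" using permutes_in_image[OF p(1), of i] by simp
      then show ?thesis using True len p(2)[symmetric] permute_list_nth[OF p(1)]
        by (simp add: alpha_def count_comp_word)
    next
      case False
      then show ?thesis using len permutes_not_in[OF p(1), of i] by (simp add: alpha_def count_comp_word)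
    qed
  qed
  then have "Q_coeff n S (alpha ks) = Q_coeff n S (alpha ks')"
    using S(2) permutes_bij[OF p(1)] by (simp add: symmetric_set_def)
  then show "block_sum (des_count n S) (map (\<lambda>k. (k, {})) ks) = block_sum (des_count n S) (map (\<lambda>k. (k, {})) ks')"
    using sum[OF ks(1,2)] sum[OF ks'] by simp
qed

lemma card_eq_sum_des_count:
  assumes "finite S"
  shows "card S = (\<Sum>D\<in>Pow {1..<n}. des_count n S D)"
proof -
  have "card S = (\<Sum>w\<in>S. 1)" by simp
  also have "\<dots> = (\<Sum>D\<in>Pow {1..<n}. \<Sum>w\<in>{w \<in> S. Des n w = D}. 1)"
    using assms Des_subset by (intro sum.group[symmetric]) auto
  finally show ?thesis by (simp add: des_count_def)
qed

lemma Des_empty_iota: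
  assumes "w \<in> Sym n" "Des n w = {}"
  shows "w = iota n"
proof
  fix i
  have perm: "w permutes {1..n}" using assms(1) by (simp add: Sym_def)
  have rng: "1 \<le> w i \<and> w i \<le> n" if "1 \<le> i" "i \<le> n" for i
    using permutes_in_image[OF perm, of i] that by simp
  have inc: "w i < w (Suc i)" if "1 \<le> i" "i < n" for i
  proof -
    have "\<not> w i > w (Suc i)" using assms(2) that by (auto simp: Des_def)
    moreover have "w i \<noteq> w (Suc i)" using permutes_inj[OF perm] by (metis injD n_not_Suc_n)
    ultimately show ?thesis by simp
  qed
  show "w i = iota n i"
  proof (cases "1 \<le> i \<and> i \<le> n")
    case True
    have ge: "i \<le> n \<longrightarrow> i \<le> w i" if "1 \<le> i" for i
      using that
    proof (induction i rule: nat_induct_at_least)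
      case (Suc i) then show ?case using inc[of i] by auto
    qed (use rng in auto)
    have le: "1 \<le> n - k \<longrightarrow> w (n - k) \<le> n - k" for k
    proof (induction k)
      case (Suc k)
      then show ?case using inc[of "n - Suc k"] by (auto simp: Suc_diff_Suc)
    qed (use rng in auto)
    show ?thesis using True ge[of i] le[of "n - i"] by (auto simp: iota_def)
  next
    case False
    then show ?thesis using permutes_not_in[OF perm, of i] by (simp add: iota_def)
  qed
qed

lemma Des_full_delta:
  assumes "w \<in> Sym n" "Des n w = {1..<n}"
  shows "w = delta n"
proof
  fix i
  have perm: "w permutes {1..n}" using assms(1) by (simp add: Sym_def)
  have rng: "1 \<le> w i \<and> w i \<le> n" if "1 \<le> i" "i \<le> n" for i
    using permutes_in_image[OF perm, of i] that by simp
  have dec: "w (Suc i) < w i" if "1 \<le> i" "i < n" for i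
  proof -
    have "i \<in> Des n w" using assms(2) that by auto
    then show ?thesis by (simp add: Des_def)
  qed
  show "w i = delta n i"
  proof (cases "1 \<le> i \<and> i \<le> n")
    case True
    have le: "i \<le> n \<longrightarrow> w i + i \<le> n + 1" if "1 \<le> i" for i
      using that
    proof (induction i rule: nat_induct_at_least)
      case (Suc i) then show ?case using dec[of i] by auto
    qed (use rng in auto)
    have ge: "1 \<le> n - k \<longrightarrow> k + 1 \<le> w (n - k)" for k
    proof (induction k)
      case (Suc k)
      then show ?case using dec[of "n - Suc k"] by (auto simp: Suc_diff_Suc)
    qed (use rng in auto)
    show ?thesis using True le[of i] ge[of "n - i"] by (auto simp: delta_def)
  next
    case False
    then show ?thesis using permutes_not_in[OF perm, of i] by (auto simp: delta_def)
  qed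
qed

section \<open>Sizes of symmetric sets\<close>

text \<open>The sizes of symmetric sets are, in this range, the semigroup generated by \<open>n - 1\<close> and \<open>n\<close>
  together with the dimensions \<open>n (n - 3) / 2\<close> and \<open>(n - 1) (n - 2) / 2\<close> of the Specht modules of
  shapes \<open>(n - 2, 2)\<close> and \<open>(n - 2, 1, 1)\<close> plus semigroup elements.\<close>
definition size_form :: "int \<Rightarrow> int \<Rightarrow> bool" where
  "size_form n p \<longleftrightarrow>
     (\<exists>a b. 0 \<le> a \<and> 0 \<le> b \<and> p = a * (n - 1) + b * n)
   \<or> (\<exists>a b. 0 \<le> a \<and> 0 \<le> b \<and> 2 * p = n * (n - 3) + 2 * (a * (n - 1) + b * n))
   \<or> (\<exists>b. 0 \<le> b \<and> 2 * p = (n - 1) * (n - 2) + 2 * (b * n))"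

text \<open>The third form is not visibly closed under adding n - 1; the identity (n - 1) (n - 2) /
  2 + (n - 1) = n (n - 3) / 2 + n moves it to the second.\<close>

lemma size_form_add_generators:
  assumes "size_form n p" "0 \<le> a'" "0 \<le> b'"
  shows "size_form n (p + (a' * (n - 1) + b' * n))"
  using assms(1) unfolding size_form_def
proof (elim disjE exE conjE)
  fix a b assume *: "0 \<le> a" "0 \<le> b" "p = a * (n - 1) + b * n"
  then have "p + (a' * (n - 1) + b' * n) = (a + a') * (n - 1) + (b + b') * n" by (simp add: algebra_simps)
  moreover have "0 \<le> a + a'" "0 \<le> b + b'" using * assms by auto
  ultimately show "(\<exists>a b. 0 \<le> a \<and> 0 \<le> b \<and> p + (a' * (n - 1) + b' * n) = a * (n - 1) + b * n)
   \<or> (\<exists>a b. 0 \<le> a \<and> 0 \<le> b \<and> 2 * (p + (a' * (n - 1) + b' * n)) = n * (n - 3) + 2 * (a * (n - 1) + b * n))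
   \<or> (\<exists>b. 0 \<le> b \<and> 2 * (p + (a' * (n - 1) + b' * n)) = (n - 1) * (n - 2) + 2 * (b * n))" by blast
next
  fix a b assume *: "0 \<le> a" "0 \<le> b" "2 * p = n * (n - 3) + 2 * (a * (n - 1) + b * n)"
  then have "2 * (p + (a' * (n - 1) + b' * n)) = n * (n - 3) + 2 * ((a + a') * (n - 1) + (b + b') * n)" by (simp add: algebra_simps)
  moreover have "0 \<le> a + a'" "0 \<le> b + b'" using * assms by auto
  ultimately show "(\<exists>a b. 0 \<le> a \<and> 0 \<le> b \<and> p + (a' * (n - 1) + b' * n) = a * (n - 1) + b * n)
   \<or> (\<exists>a b. 0 \<le> a \<and> 0 \<le> b \<and> 2 * (p + (a' * (n - 1) + b' * n)) = n * (n - 3) + 2 * (a * (n - 1) + b * n))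
   \<or> (\<exists>b. 0 \<le> b \<and> 2 * (p + (a' * (n - 1) + b' * n)) = (n - 1) * (n - 2) + 2 * (b * n))" by blast
next
  fix b assume *: "0 \<le> b" "2 * p = (n - 1) * (n - 2) + 2 * (b * n)"
  show "(\<exists>a b. 0 \<le> a \<and> 0 \<le> b \<and> p + (a' * (n - 1) + b' * n) = a * (n - 1) + b * n)
   \<or> (\<exists>a b. 0 \<le> a \<and> 0 \<le> b \<and> 2 * (p + (a' * (n - 1) + b' * n)) = n * (n - 3) + 2 * (a * (n - 1) + b * n))
   \<or> (\<exists>b. 0 \<le> b \<and> 2 * (p + (a' * (n - 1) + b' * n)) = (n - 1) * (n - 2) + 2 * (b * n))"
  proof (cases "a' = 0")
    case True
    then have "2 * (p + (a' * (n - 1) + b' * n)) = (n - 1) * (n - 2) + 2 * ((b + b') * n)"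
      using * by (simp add: algebra_simps)
    moreover have "0 \<le> b + b'" using * assms by simp
    ultimately show ?thesis by blast
  next
    case False
    have "2 * (p + (a' * (n - 1) + b' * n)) = n * (n - 3) + 2 * ((a' - 1) * (n - 1) + (b + b' + 1) * n)"
      using * by (simp add: algebra_simps)
    moreover have "0 \<le> a' - 1" "0 \<le> b + b' + 1" using * assms False by simp_all
    ultimately show ?thesis by blast
  qed
qed

lemma size_form_cases:
  assumes "size_form n p" "n \<ge> 3"
  obtains a b where "0 \<le> a" "0 \<le> b" "p = a * (n - 1) + b * n" | "n * (n - 3) \<le> 2 * p"
proof -
  have nn: "0 \<le> a * (n - 1)" "0 \<le> a * n" if "0 \<le> a" for a using that assms(2) by auto
  show ?thesis
    using assms(1) unfolding size_form_def
  proof (elim disjE exE conjE)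
    fix a b assume *: "0 \<le> a" "0 \<le> b" "2 * p = n * (n - 3) + 2 * (a * (n - 1) + b * n)"
    have "n * (n - 3) \<le> 2 * p" unfolding *(3) using nn(1)[OF *(1)] nn(2)[OF *(2)] by simp
    then show ?thesis by (rule that(2))
  next
    fix b assume *: "0 \<le> b" "2 * p = (n - 1) * (n - 2) + 2 * (b * n)"
    have "(n - 1) * (n - 2) = n * (n - 3) + 2" by (simp add: algebra_simps)
    then have "n * (n - 3) \<le> 2 * p" unfolding *(2) using nn(2)[OF *(1)] by simp
    then show ?thesis by (rule that(2))
  qed (use that(1) in blast)
qed

text \<open>Two summands that are both at least n (n - 3) / 2 would exceed the bound, so one of them
  lies in the semigroup generated by n - 1 and n.\<close>

lemma size_form_add:
  assumes "size_form n p" "size_form n q" "p + q < (n - 1) * (n - 3)" "n \<ge> 3"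
  shows "size_form n (p + q)"
proof (rule size_form_cases[OF assms(2,4)])
  fix a b assume "0 \<le> a" "0 \<le> b" "q = a * (n - 1) + b * n"
  then show ?thesis using size_form_add_generators[OF assms(1)] by simp
next
  assume q: "n * (n - 3) \<le> 2 * q"
  show ?thesis
  proof (rule size_form_cases[OF assms(1,4)])
    fix a b assume "0 \<le> a" "0 \<le> b" "p = a * (n - 1) + b * n"
    then show ?thesis using size_form_add_generators[OF assms(2)] by (simp add: add.commute)
  next
    assume p: "n * (n - 3) \<le> 2 * p"
    have "(n - 1) * (n - 3) \<le> n * (n - 3)" using assms(4) by (intro mult_right_mono) auto
    then have False using p q assms(3) by linarith
    then show ?thesis ..
  qed
qed

lemma (in low_coeffs) size_form_low:
  assumes "int (sum c low_sets) < (int n - 1) * (int n - 3)"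
  shows "size_form (int n) (int (sum c low_sets))"
proof -
  obtain c1 \<kappa> y u s :: int where *:
    "2 * int (sum c low_sets) = 2 * (int n - 1) * c1 + int n * (int n - 3) * \<kappa> + 2 * int n * y + 2 * s"
    "0 \<le> c1" "0 \<le> u" "u \<le> y" "0 \<le> \<kappa> - 2 * y + u" "0 \<le> s + y - u" "0 \<le> c1 - s + \<kappa> - 2 * y + u"
    by (rule low_sum_parameters)
  show ?thesis unfolding size_form_def
    by (rule low_sum_size_form[OF _ assms *]) (use n_large in auto)
qed

context small_total
begin

lemma low_coeffs: "low_coeffs n c"
proof
  show "20 \<le> n" using n_large by simp
  show "perm_inv n c" by (rule perm_inv)
next
  fix X assume X: "X \<subseteq> {1..<n}" "small 8 X" "has_sep3 X"
  show "c X = 0"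
  proof (rule ccontr)
    assume "c X \<noteq> 0"
    then have "card ({1..<n} - X) \<le> 4" using sep3_almost_full[of X] X by simp
    then show False using X(1,2) n_large card_Diff_subset[of X "{1..<n}"] by (auto simp: small_def)
  qed
qed

lemma compl: "small_total n (\<lambda>D. c ({1..<n} - D))"
proof
  show "(\<Sum>D\<in>Pow {1..<n}. c ({1..<n} - D)) < (n - 1) * (n - 3)"
  proof -
    have "(\<Sum>D\<in>Pow {1..<n}. c ({1..<n} - D)) = (\<Sum>D\<in>Pow {1..<n}. c D)"
      by (rule sum.reindex_bij_witness[where i = "\<lambda>D. {1..<n} - D" and j = "\<lambda>D. {1..<n} - D"])
        (auto simp: double_diff)
    then show ?thesis using total by simp
  qed
qed (use n_large perm_inv_compl[OF perm_inv] in auto)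

text \<open>A set with positive count that is neither low nor co-low would contain a separated
  triple, as would its complement; then both would have at most four elements, too few for
  \<open>n - 1\<close> positions. The same size comparison makes the two families disjoint. The
  empty and the full set are assumed away because \<open>low_sets\<close> omits the empty
  set.\<close>

lemma size_form_total:
  assumes "c {} = 0" "c {1..<n} = 0"
  shows "size_form (int n) (int (\<Sum>D\<in>Pow {1..<n}. c D))"
proof -
  interpret low: low_coeffs n c by (rule low_coeffs)
  define c' where "c' = (\<lambda>D. c ({1..<n} - D))"
  interpret co: small_total n c' unfolding c'_def by (rule compl)
  interpret colow: low_coeffs n c' by (rule co.low_coeffs)
  let ?co = "(\<lambda>D. {1..<n} - D)"
  have low_card: "card D \<le> 4" if "D \<in> low.low_sets" for D
  proof (rule ccontr)
    assume "\<not> card D \<le> 4"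
    then have "5 \<le> card D" by simp
    moreover have "finite D" using that finite_subset by (auto simp: low.low_sets_def)
    ultimately obtain a b d where "a \<in> D" "b \<in> D" "d \<in> D" "a + 2 \<le> b" "b + 2 \<le> d"
      using sep3_of_card[of D] by blast
    then have "has_sep3 D" by (auto simp: has_sep3_def)
    then show False using that by (simp add: low.low_sets_def)
  qed
  have fin: "finite low.low_sets"
    by (rule finite_subset[of _ "Pow {1..<n}"]) (auto simp: low.low_sets_def)
  have card2: "card D + card (?co D) = n - 1" if "D \<subseteq> {1..<n}" for D
    using that card_mono[of "{1..<n}" D] by (simp add: card_Diff_subset finite_subset)
  have inj: "inj_on ?co low.low_sets"
    by (rule inj_onI) (metis (no_types, lifting) double_diff low.low_sets_def mem_Collect_eq order_refl)
  have dis: "low.low_sets \<inter> ?co ` low.low_sets = {}"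
  proof (rule ccontr)
    assume "\<not> ?thesis"
    then obtain D where D: "D \<in> low.low_sets" "?co D \<in> low.low_sets" by auto
    then show False using low_card[OF D(1)] low_card[OF D(2)] card2[of D] n_large
      by (simp add: low.low_sets_def)
  qed
  have "(\<Sum>D\<in>Pow {1..<n}. c D) = (\<Sum>D\<in>low.low_sets \<union> ?co ` low.low_sets. c D)"
  proof (rule sum.mono_neutral_right)
    show "\<forall>D\<in>Pow {1..<n} - (low.low_sets \<union> ?co ` low.low_sets). c D = 0"
    proof (rule ballI, rule ccontr)
      fix D assume D: "D \<in> Pow {1..<n} - (low.low_sets \<union> ?co ` low.low_sets)" and cD: "c D \<noteq> 0"
      have dd: "?co (?co D) = D" using D by (auto simp: double_diff)
      have "D \<noteq> {}" using cD assms by auto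
      then have "has_sep3 D" using D by (auto simp: low.low_sets_def)
      then have c1: "card (?co D) \<le> 4" using sep3_almost_full[of D] D cD by auto
      have "?co D \<noteq> {}"
      proof
        assume e: "?co D = {}"
        have "D = {1..<n}" using dd unfolding e by simp
        then show False using cD assms(2) by simp
      qed
      moreover have "?co D \<notin> low.low_sets" using D dd by (metis DiffD2 UnI2 imageI)
      ultimately have "has_sep3 (?co D)" by (auto simp: low.low_sets_def)
      then have "card (?co (?co D)) \<le> 4"
        using co.sep3_almost_full[of "?co D"] cD dd by (simp add: c'_def)
      then show False using c1 card2[of D] D n_large dd by simp
    qed
  qed (auto simp: low.low_sets_def)
  also have "\<dots> = sum c low.low_sets + sum c (?co ` low.low_sets)"
    using fin dis by (intro sum.union_disjoint) auto
  also have "sum c (?co ` low.low_sets) = sum c' colow.low_sets"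
    unfolding sum.reindex[OF inj] c'_def by (simp add: comp_def)
  finally have sum: "(\<Sum>D\<in>Pow {1..<n}. c D) = sum c low.low_sets + sum c' colow.low_sets" .
  have tot: "int (sum c low.low_sets) + int (sum c' colow.low_sets) < (int n - 1) * (int n - 3)"
  proof -
    have "int (sum c low.low_sets + sum c' colow.low_sets) < int ((n - 1) * (n - 3))"
      using total sum by (simp only: of_nat_less_iff)
    then show ?thesis using n_large by (simp add: of_nat_diff)
  qed
  have parts: "int (sum c low.low_sets) < (int n - 1) * (int n - 3)"
    "int (sum c' colow.low_sets) < (int n - 1) * (int n - 3)"
    using tot of_nat_0_le_iff[of "sum c low.low_sets"] of_nat_0_le_iff[of "sum c' colow.low_sets"]
    by linarith+
  show ?thesis unfolding sum of_nat_add
    by (rule size_form_add[OF low.size_form_low[OF parts(1)] colow.size_form_low[OF parts(2)] tot])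
      (use n_large in simp)
qed

end

theorem size_form_symmetric_set:
  assumes "n \<ge> 52" "S \<subseteq> Sym n" "symmetric_set n S" "iota n \<notin> S" "delta n \<notin> S" "card S < (n - 1) * (n - 3)"
  shows "size_form (int n) (int (card S))"
proof -
  have fin: "finite S" by (rule finite_subset[OF assms(2) finite_Sym])
  note card_eq = card_eq_sum_des_count[OF fin, of n]
  interpret small_total n "des_count n S"
  proof
    show "perm_inv n (des_count n S)" by (rule perm_inv_des_count[OF assms(2,3)])
  qed (use assms(1,6) card_eq in simp_all)
  have "{w \<in> S. Des n w = {}} = {}" "{w \<in> S. Des n w = {1..<n}} = {}"
    using Des_empty_iota Des_full_delta assms by blast+
  then have "des_count n S {} = 0" "des_count n S {1..<n} = 0" by (simp_all only: des_count_def card.empty)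
  then show ?thesis unfolding card_eq by (rule size_form_total)
qed

text \<open>Parity decides which exceptional dimension is new. For even n, (n - 1) (n - 2) / 2 is a
  multiple of n - 1 and n (n - 3) / 2 + n = (n / 2) (n - 1), so the second form gives something new
  only for b = 0. For odd n, n (n - 3) / 2 is a multiple of n.\<close>

lemma size_form_imp_cases:
  fixes n p :: nat
  assumes n: "n \<ge> 52" and p: "p < (n - 1) * (n - 3)" and form: "size_form (int n) (int p)"
  shows "(\<exists>q r :: int. 0 \<le> r \<and> r \<le> q \<and> q < int n - 3 \<and> int p = q * int n - r)
    \<or> (even n \<and> (\<exists>c :: nat. p = n * (n - 3) div 2 + c * (n - 1)))
    \<or> (odd n \<and> (\<exists>c :: nat. p = (n - 1 choose 2) + c * n))"
proof -
  have pi: "int p < (int n - 1) * (int n - 3)"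
  proof -
    have "int p < int ((n - 1) * (n - 3))" using p by (simp only: of_nat_less_iff)
    then show ?thesis using n by (simp add: of_nat_diff)
  qed
  have G: ?thesis if ab: "0 \<le> a" "0 \<le> b" "int p = a * (int n - 1) + b * int n" for a b
  proof -
    have "a + b < int n - 3"
    proof (rule ccontr)
      assume "\<not> ?thesis"
      then have "(int n - 3) * (int n - 1) \<le> (a + b) * (int n - 1)" using n by (intro mult_right_mono) auto
      also have "\<dots> \<le> int p" using ab by (simp add: algebra_simps)
      finally show False using pi by (simp add: mult.commute)
    qed
    moreover have "int p = (a + b) * int n - a" using ab by (simp add: algebra_simps)
    ultimately show ?thesis using ab by (intro disjI1 exI[of _ "a + b"] exI[of _ a]) auto
  qed
  show ?thesis using form unfolding size_form_def
  proof (elim disjE exE conjE)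
    fix a b assume *: "0 \<le> a" "0 \<le> b" "2 * int p = int n * (int n - 3) + 2 * (a * (int n - 1) + b * int n)"
    show ?thesis
    proof (cases "even n")
      case True
      then obtain m where m: "n = 2 * m" by blast
      show ?thesis
      proof (cases "b = 0")
        case True
        obtain c where c: "a = int c" using * nonneg_int_cases by blast
        have "int p = int m * (2 * int m - 3) + a * (2 * int m - 1)" using * True m by (simp add: algebra_simps)
        also have "\<dots> = int (m * (n - 3) + c * (n - 1))" using n m c by (simp add: of_nat_diff)
        finally have "p = m * (n - 3) + c * (n - 1)" by (simp only: of_nat_eq_iff)
        moreover have "n * (n - 3) div 2 = m * (n - 3)" using m by simp
        ultimately show ?thesis using \<open>even n\<close> by auto
      next
        case False
        have "int p = (a + int m) * (int n - 1) + (b - 1) * int n" using * m by (simp add: algebra_simps)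
        then show ?thesis using * False by (intro G) auto
      qed
    next
      case False
      then obtain m where m: "n = 2 * m + 1" using oddE by blast
      have "int p = a * (int n - 1) + (b + (int m - 1)) * int n" using * m by (simp add: algebra_simps)
      then show ?thesis using * n m by (intro G) auto
    qed
  next
    fix b assume *: "0 \<le> b" "2 * int p = (int n - 1) * (int n - 2) + 2 * (b * int n)"
    show ?thesis
    proof (cases "even n")
      case True
      then obtain m where m: "n = 2 * m" by blast
      have "int p = (int m - 1) * (int n - 1) + b * int n" using * m by (simp add: algebra_simps)
      then show ?thesis using * n m by (intro G) auto
    next
      case False
      then obtain m where m: "n = 2 * m + 1" using oddE by blast
      obtain c where c: "b = int c" using * nonneg_int_cases by blast
      have "int p = int m * (2 * int m - 1) + b * int n" using * m by (simp add: algebra_simps)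
      also have "2 * int m - 1 = int (n - 2)" using n m by (simp add: of_nat_diff)
      also have "int m * int (n - 2) + b * int n = int (m * (n - 2) + c * n)" using c by simp
      finally have "p = m * (n - 2) + c * n" by (simp only: of_nat_eq_iff)
      moreover have "(n - 1 choose 2) = m * (n - 2)" using m by (simp add: choose_two)
      ultimately show ?thesis using False by auto
    qed
  qed (use G in blast)
qed

text \<open>With n = 2 M, comparing the expressions gives r = 2 M k + 3 M + C for k = q - M - C.
  Then r \<le> q forces k \<le> -2, and r \<ge> 0 forces C \<ge> M, which makes p too large.\<close>

lemma case1_case2_exclusive:
  fixes n p :: nat and q r :: int
  assumes n: "n \<ge> 52" and p: "p < (n - 1) * (n - 3)"
    and qr: "0 \<le> r" "r \<le> q" "q < int n - 3" "int p = q * int n - r"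
    and ev: "even n" "p = n * (n - 3) div 2 + c * (n - 1)"
  shows False
proof -
  obtain m where m: "n = 2 * m" using ev by blast
  define M C where "M = int m" and "C = int c"
  have nM: "int n = 2 * M" "26 \<le> M" "0 \<le> C" using n m by (auto simp: M_def C_def)
  have pM: "int p = M * (2 * M - 3) + C * (2 * M - 1)"
    using ev m n by (simp add: M_def C_def of_nat_diff)
  have pi: "int p < (2 * M - 1) * (2 * M - 3)"
    using p n m by (simp add: M_def of_nat_diff zless_nat_eq_int_zless flip: of_nat_less_iff[where 'a = int])
  define k where "k = q - M - C"
  have r: "r = 2 * M * k + 3 * M + C" using qr(4) pM nM(1) by (simp add: k_def algebra_simps)
  have "k < - 1"
  proof (rule ccontr)
    assume "\<not> ?thesis"
    then have "(2 * M - 1) * (- 1) \<le> (2 * M - 1) * k" using nM by (intro mult_left_mono) auto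
    then show False using r qr(2) by (simp add: k_def algebra_simps)
  qed
  then have "2 * M * k \<le> 2 * M * (- 2)" using nM by (intro mult_left_mono) auto
  then have "M \<le> C" using r qr(1) by simp
  then have "M * (2 * M - 1) \<le> C * (2 * M - 1)" using nM by (intro mult_right_mono) auto
  then show False using pi pM nM by (simp add: algebra_simps)
qed

text \<open>For odd n the binomial coefficient is 1 modulo n, so r would be -1 modulo n and thus at
  least n - 1.\<close>

lemma case1_case3_exclusive:
  fixes n p :: nat and q r :: int
  assumes n: "n \<ge> 52"
    and qr: "0 \<le> r" "r \<le> q" "q < int n - 3" "int p = q * int n - r"
    and od: "odd n" "p = (n - 1 choose 2) + c * n"
  shows False
proof -
  obtain m where m: "n = 2 * m + 1" using od oddE by blast
  have "(n - 1 choose 2) = m * (n - 2)" using m by (simp add: choose_two)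
  then have "int p = int m * (int n - 2) + int c * int n" using od n by (simp add: of_nat_diff)
  then have r: "r + 1 = int n * (q - int c - int m + 1)" using qr(4) m by (simp add: algebra_simps)
  then have "0 < int n * (q - int c - int m + 1)" using qr(1) by simp
  then have "1 \<le> q - int c - int m + 1" using n by (simp add: zero_less_mult_iff)
  then have "int n * 1 \<le> int n * (q - int c - int m + 1)" by (intro mult_left_mono) auto
  then have "int n \<le> r + 1" unfolding r by simp
  then show False using qr(2,3) by simp
qed

section \<open>Permutations with a given small descent set\<close>

definition rot :: "nat \<Rightarrow> nat \<Rightarrow> nat \<Rightarrow> nat" where
  "rot n k y = (y - 1 + k) mod n + 1"

lemma mod_Suc_cancel: "Suc a mod n = Suc b mod n \<Longrightarrow> a mod n = b mod (n::nat)"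
  by (cases "n = 0") (auto simp: mod_Suc split: if_splits)

lemma mod_add_cancel: "(x + a) mod n = (x + b) mod n \<Longrightarrow> a mod n = b mod (n::nat)"
  by (induction x) (auto dest: mod_Suc_cancel)

lemma inj_on_rot: "inj_on (rot n k) {1..n}"
proof (rule inj_onI)
  fix x y assume xy: "x \<in> {1..n}" "y \<in> {1..n}" "rot n k x = rot n k y"
  then have "(k + (x - 1)) mod n = (k + (y - 1)) mod n" by (simp add: rot_def add.commute)
  then have "(x - 1) mod n = (y - 1) mod n" by (rule mod_add_cancel)
  moreover have "x - 1 < n" "y - 1 < n" using xy(1,2) by auto
  ultimately have "x - 1 = y - 1" by simp
  then show "x = y" using xy(1,2) by auto
qed

lemma bij_betw_rot: "bij_betw (rot n k) {1..n} {1..n}"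
proof -
  have "rot n k ` {1..n} \<subseteq> {1..n}" by (auto simp: rot_def Suc_leI)
  then show ?thesis using inj_on_rot[of n k] by (simp add: bij_betw_def endo_inj_surj)
qed

lemma rot_Suc:
  assumes "1 \<le> y" "rot n k (Suc y) \<noteq> 1"
  shows "rot n k (Suc y) = Suc (rot n k y)"
proof -
  have "Suc (y - 1 + k) mod n \<noteq> 0" using assms by (simp add: rot_def)
  then have "Suc (y - 1 + k) mod n = Suc ((y - 1 + k) mod n)" by (auto simp: mod_Suc split: if_splits)
  then show ?thesis using assms(1) by (simp add: rot_def)
qed

lemma rot_eq_1:
  assumes "1 \<le> i" "i < n" "k < n" "rot n k (n - i + 1) = 1"
  shows "k = i"
proof -
  have "(n - i + k) mod n = 0" using assms by (simp add: rot_def)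
  then obtain q where q: "n - i + k = n * q" by auto
  have "n * q < n * 2" using q assms by linarith
  then have "q < 2" by simp
  moreover have "q \<noteq> 0" using q assms by (metis add_is_0 less_not_refl mult_0_right zero_less_diff)
  ultimately have "q = 1" by simp
  then show ?thesis using q assms by simp
qed

text \<open>A proper cyclic interval has exactly one element whose cyclic predecessor lies outside
  it, namely its start; so the interval determines the image of \<open>n - i + 1\<close> and thereby
  the rotation.\<close>

lemma rot_top_inj:
  assumes i: "1 \<le> i" "i < n" and k: "k < n" "k' < n"
    and eq: "rot n k ` {n - i + 1..n} = rot n k' ` {n - i + 1..n}"
  shows "k = k'"
proof -
  have "rot n k (n - i + 1) \<in> rot n k' ` {n - i + 1..n}" unfolding eq[symmetric] using i by auto
  then obtain z where z: "z \<in> {n - i + 1..n}" "rot n k (n - i + 1) = rot n k' z" by auto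
  have e: "Suc (n - i - 1 + k) mod n = Suc (z - 2 + k') mod n"
  proof -
    have "n - i + 1 - 1 + k = Suc (n - i - 1 + k)" "z - 1 + k' = Suc (z - 2 + k')" using z(1) i by auto
    then show ?thesis using z(2) by (simp add: rot_def)
  qed
  have "z = n - i + 1"
  proof (rule ccontr)
    assume "z \<noteq> n - i + 1"
    then have z1: "z - 1 \<in> {n - i + 1..n}" using z(1) by auto
    have "rot n k (n - i) = rot n k' (z - 1)"
      using mod_Suc_cancel[OF e] i z(1) by (simp add: rot_def numeral_2_eq_2)
    then have "rot n k (n - i) \<in> rot n k ` {n - i + 1..n}" using z1 eq by auto
    then obtain y where "y \<in> {n - i + 1..n}" "rot n k (n - i) = rot n k y" by auto
    moreover have "n - i \<in> {1..n}" using i by simp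
    moreover have "y \<in> {1..n}" using calculation(1) by simp
    ultimately have "n - i = y" using inj_onD[OF inj_on_rot[of n k]] by blast
    then show False using \<open>y \<in> {n - i + 1..n}\<close> by simp
  qed
  then have "((n - i) + k) mod n = ((n - i) + k') mod n" using z(2) by (simp add: rot_def)
  then have "k mod n = k' mod n" by (rule mod_add_cancel)
  then show ?thesis using k by simp
qed

section \<open>Permutations assembled from increasing segments\<close>

definition perm_of_list :: "nat \<Rightarrow> nat list \<Rightarrow> nat \<Rightarrow> nat" where
  "perm_of_list n xs = (\<lambda>x. if x \<in> {1..n} then xs ! (x - 1) else x)"

lemma perm_of_list_permutes:
  assumes "distinct xs" "set xs = {1..n}"
  shows "perm_of_list n xs \<in> Sym n"
proof -
  have len: "length xs = n" using distinct_card[OF assms(1)] assms(2) by simp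
  have "inj_on (perm_of_list n xs) {1..n}"
    using assms(1) len by (auto simp: inj_on_def perm_of_list_def nth_eq_iff_index_eq)
  moreover have "perm_of_list n xs ` {1..n} \<subseteq> {1..n}"
  proof
    fix y assume "y \<in> perm_of_list n xs ` {1..n}"
    then obtain x where "x \<in> {1..n}" "y = xs ! (x - 1)" by (auto simp: perm_of_list_def)
    then have "y \<in> set xs" using len by (auto intro: nth_mem)
    then show "y \<in> {1..n}" using assms(2) by simp
  qed
  ultimately have "bij_betw (perm_of_list n xs) {1..n} {1..n}" by (simp add: bij_betw_def endo_inj_surj)
  then show ?thesis unfolding Sym_def mem_Collect_eq by (rule bij_imp_permutes) (auto simp: perm_of_list_def)
qed

lemma Des_perm_of_list: "Des n (perm_of_list n xs) = {x \<in> {1..<n}. xs ! x < xs ! (x - 1)}"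
  by (auto simp: Des_def perm_of_list_def)

lemma sorted_list_hd_le:
  assumes "finite R" "y \<in> R"
  shows "sorted_list_of_set R ! 0 \<le> y"
proof -
  obtain k where "k < length (sorted_list_of_set R)" "sorted_list_of_set R ! k = y"
    using assms by (metis in_set_conv_nth set_sorted_list_of_set)
  then show ?thesis using sorted_nth_mono[OF sorted_sorted_list_of_set[of R], of 0 k] by simp
qed

lemma sorted_list_last_ge:
  assumes "finite R" "y \<in> R"
  shows "y \<le> sorted_list_of_set R ! (card R - 1)"
proof -
  obtain k where "k < length (sorted_list_of_set R)" "sorted_list_of_set R ! k = y"
    using assms by (metis in_set_conv_nth set_sorted_list_of_set)
  then show ?thesis using sorted_nth_mono[OF sorted_sorted_list_of_set[of R], of k "card R - 1"] by simp
qed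

text \<open>With each segment written increasingly, descents occur at borders only, and a border is
  a descent once some value before it exceeds some value after it, since the last entry of a segment
  is its maximum and the first its minimum. For \<open>i = j\<close> the middle segment is
  empty.\<close>

lemma perm_with_segments:
  assumes R: "R1 \<union> R2 \<union> R3 = {1..n}" "R1 \<inter> R2 = {}" "R1 \<inter> R3 = {}" "R2 \<inter> R3 = {}"
    and card: "card R1 = i" "card R2 = j - i" "card R3 = n - j"
    and ij: "1 \<le> i" "i \<le> j" "j < n"
    and desc: "\<exists>x\<in>R1. \<exists>y\<in>(if i < j then R2 else R3). y < x" "i < j \<Longrightarrow> \<exists>x\<in>R2. \<exists>y\<in>R3. y < x"
  obtains w where "w \<in> Sym n" "Des n w = {i, j}" "w ` {1..i} = R1"
proof -
  define s where "s = (sorted_list_of_set :: nat set \<Rightarrow> nat list)"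
  define xs where "xs = s R1 @ s R2 @ s R3"
  have fin: "finite R1" "finite R2" "finite R3"
    using R(1) by (metis finite_Un finite_atLeastAtMost)+
  have len: "length (s R1) = i" "length (s R2) = j - i" "length (s R3) = n - j"
    using card by (simp_all add: s_def)
  have st: "s R ! a < s R ! Suc a" if "Suc a < card R" for R a
    using sorted_wrt_nth_less[OF strict_sorted_list_of_set[of R], of a "Suc a"] that by (simp add: s_def)
  have "distinct xs" "set xs = {1..n}" using R fin by (auto simp: xs_def s_def)
  then have "perm_of_list n xs \<in> Sym n" by (rule perm_of_list_permutes)
  moreover have "Des n (perm_of_list n xs) = {i, j}"
  proof -
    have nth: "xs ! x = (if x < i then s R1 ! x else if x < j then s R2 ! (x - i) else s R3 ! (x - j))" for x
      using len ij by (auto simp: xs_def nth_append)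
    have asc: "xs ! (x - 1) < xs ! x" if "x \<in> {1..<n}" "x \<noteq> i" "x \<noteq> j" for x
    proof -
      have "x < i \<or> (i < x \<and> x < j) \<or> j < x" using that(2,3) by arith
      then consider "x < i" | "i < x" "x < j" | "j < x" by blast
      then show ?thesis
      proof cases
        case 1
        have "x - 1 < i" "Suc (x - 1) = x" using 1 that(1) by auto
        then show ?thesis using st[of "x - 1" R1] 1 card by (simp add: nth)
      next
        case 2
        have "\<not> x - 1 < i" "x - 1 < j" "x - 1 - i = x - Suc i" "Suc (x - Suc i) = x - i" using 2 by auto
        then show ?thesis using st[of "x - Suc i" R2] 2 card by (simp add: nth)
      next
        case 3
        have "\<not> x - 1 < i" "\<not> x - 1 < j" "x - 1 - j = x - Suc j" "Suc (x - Suc j) = x - j" using 3 ij by auto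
        then show ?thesis using st[of "x - Suc j" R3] 3 that(1) card ij by (simp add: nth)
      qed
    qed
    have last: "y \<le> s R ! (card R - 1)" "s R ! 0 \<le> y" if "finite R" "y \<in> R" for y R
      using sorted_list_last_ge[OF that] sorted_list_hd_le[OF that] by (simp_all add: s_def)
    have di: "xs ! i < xs ! (i - 1)"
    proof -
      obtain x y where xy: "x \<in> R1" "y \<in> (if i < j then R2 else R3)" "y < x" using desc(1) by blast
      have "xs ! i = s (if i < j then R2 else R3) ! 0" using ij by (simp add: nth)
      also have "\<dots> \<le> y" by (rule last(2)) (use xy fin in auto)
      also have "y < x" by fact
      also have "x \<le> xs ! (i - 1)" using last(1)[OF fin(1) xy(1)] card ij by (simp add: nth)
      finally show ?thesis .
    qed
    have dj: "xs ! j < xs ! (j - 1)"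
    proof (cases "i < j")
      case True
      obtain x y where xy: "x \<in> R2" "y \<in> R3" "y < x" using desc(2)[OF True] by blast
      have "xs ! j = s R3 ! 0" using ij by (simp add: nth)
      also have "\<dots> \<le> y" by (rule last(2)) (use xy fin in auto)
      also have "y < x" by fact
      also have "x \<le> xs ! (j - 1)" using last(1)[OF fin(2) xy(1)] card True by (auto simp: nth)
      finally show ?thesis .
    qed (use di ij in simp)
    show ?thesis unfolding Des_perm_of_list
    proof (intro set_eqI iffI)
      fix x assume "x \<in> {x \<in> {1..<n}. xs ! x < xs ! (x - 1)}"
      then have "x \<in> {1..<n}" "\<not> xs ! (x - 1) < xs ! x" by auto
      then show "x \<in> {i, j}" using asc[of x] by blast
    qed (use di dj ij in auto)
  qed
  moreover have "perm_of_list n xs ` {1..i} = R1"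
  proof -
    have "perm_of_list n xs ` {1..i} = (\<lambda>x. s R1 ! (x - 1)) ` {1..i}"
      using ij len by (intro image_cong) (auto simp: perm_of_list_def xs_def nth_append)
    also have "\<dots> = (!) (s R1) ` {0..<i}"
    proof -
      have "{1..i} = Suc ` {0..<i}" by (simp add: atLeastLessThanSuc_atLeastAtMost)
      then show ?thesis by (simp only: image_image diff_Suc_1)
    qed
    also have "\<dots> = set (s R1)" using len(1) by (auto simp: set_conv_nth)
    also have "\<dots> = R1" using fin(1) by (simp add: s_def)
    finally show ?thesis .
  qed
  ultimately show ?thesis using that by blast
qed

text \<open>Cut \<open>{1..n}\<close> into value intervals, the top one for the first segment of positions and so on.
  All cyclic rotations of the values but two keep a descent at both segment borders.\<close>
lemma exists_perms:
  assumes ij: "1 \<le> i" "i \<le> j" "j < n" and m: "m + 2 \<le> n"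
  shows "\<exists>W. W \<subseteq> {w \<in> Sym n. Des n w = {i, j}} \<and> card W = m"
proof -
  define K where "K = {..<n} - {i, j}"
  define R where "R k = rot n k ` {n - i + 1..n}" for k
  have "\<exists>w. w \<in> Sym n \<and> Des n w = {i, j} \<and> w ` {1..i} = R k" if k: "k \<in> K" for k
  proof -
    let ?R2 = "rot n k ` {n - j + 1..n - i}" and ?R3 = "rot n k ` {1..n - j}"
    have inj: "inj_on (rot n k) A" if "A \<subseteq> {1..n}" for A
      using inj_on_subset[OF inj_on_rot that] .
    have cd: "card (R k) = i" "card ?R2 = j - i" "card ?R3 = n - j"
      unfolding R_def using ij by (subst card_image; (intro inj)?; auto)+
    have dis: "rot n k ` A \<inter> rot n k ` B = {}" if "A \<subseteq> {1..n}" "B \<subseteq> {1..n}" "A \<inter> B = {}" for A B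
      using that inj_on_image_Int[OF inj_on_rot, of A n B k] by simp
    have un: "R k \<union> ?R2 \<union> ?R3 = {1..n}"
    proof -
      have "{n - i + 1..n} \<union> {n - j + 1..n - i} \<union> {1..n - j} = {1..n}" using ij by auto
      then show ?thesis using bij_betw_rot[of n k] unfolding R_def bij_betw_def image_Un[symmetric] by simp
    qed
    have drop: "rot n k (n - l) < rot n k (n - l + 1)" if "1 \<le> l" "l < n" "k \<noteq> l" for l
    proof -
      have "1 \<le> n - l" "rot n k (Suc (n - l)) \<noteq> 1"
        using that rot_eq_1[of l n k] k by (auto simp: K_def)
      then show ?thesis using rot_Suc[of "n - l" n k] by simp
    qed
    have 1: "\<exists>x\<in>R k. \<exists>y\<in>(if i < j then ?R2 else ?R3). y < x"
    proof (intro bexI)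
      show "rot n k (n - i) < rot n k (n - i + 1)" using drop[of i] k ij by (simp add: K_def)
      show "rot n k (n - i + 1) \<in> R k" unfolding R_def using ij by (intro imageI) simp
      show "rot n k (n - i) \<in> (if i < j then ?R2 else ?R3)" using ij by auto
    qed
    have 2: "\<exists>x\<in>?R2. \<exists>y\<in>?R3. y < x" if "i < j"
    proof (intro bexI)
      show "rot n k (n - j) < rot n k (n - j + 1)" using drop[of j] k ij by (simp add: K_def)
      show "rot n k (n - j + 1) \<in> ?R2" using ij that by (intro imageI) simp
      show "rot n k (n - j) \<in> ?R3" using ij by (intro imageI) simp
    qed
    have d: "R k \<inter> ?R2 = {}" "R k \<inter> ?R3 = {}" "?R2 \<inter> ?R3 = {}"
      unfolding R_def by (rule dis; use ij in force)+
    show ?thesis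
      by (rule perm_with_segments[OF un d cd ij 1 2]) blast+
  qed
  then obtain w where w: "\<And>k. k \<in> K \<Longrightarrow> w k \<in> Sym n \<and> Des n (w k) = {i, j} \<and> w k ` {1..i} = R k" by metis
  \<comment> \<open>Different rotations already differ in the set of values on the first
    \<open>i\<close> positions.\<close>
  have "inj_on w K"
  proof (rule inj_onI)
    fix k k' assume "k \<in> K" "k' \<in> K" "w k = w k'"
    moreover from this have "R k = R k'" using w by metis
    ultimately show "k = k'" using rot_top_inj[of i n k k'] ij by (auto simp: R_def K_def)
  qed
  then have "card (w ` K) = card K" by (rule card_image)
  moreover have "n - 2 \<le> card K"
    using diff_card_le_card_Diff[of "{i, j}" "{..<n}"] card_insert_le_m1[of 2 "{j}" i] unfolding K_def by simp
  ultimately have "m \<le> card (w ` K)" using m by simp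
  then obtain W where W: "W \<subseteq> w ` K" "card W = m" by (metis obtain_subset_with_card_n)
  have "w ` K \<subseteq> {w \<in> Sym n. Des n w = {i, j}}" using w by auto
  then have "W \<subseteq> {w \<in> Sym n. Des n w = {i, j}}" using W(1) by (rule subset_trans[rotated])
  then show ?thesis using W(2) by blast
qed

section \<open>Construction of symmetric sets\<close>

text \<open>A pair \<open>(i, j)\<close> stands for the descent set \<open>{i, j}\<close>; the
  diagonal encodes the singletons, so one index set covers all descent sets with one or two
  elements.\<close>

definition ordered_pairs :: "nat set \<Rightarrow> (nat \<times> nat) set" where
  "ordered_pairs C = {(i, j). i \<in> C \<and> j \<in> C \<and> i \<le> j}"

lemma finite_ordered_pairs: "finite C \<Longrightarrow> finite (ordered_pairs C)"
  by (rule finite_subset[of _ "C \<times> C"]) (auto simp: ordered_pairs_def)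

text \<open>The counts are given for all \<open>C\<close> at once because
  \<open>Q_coeff_card\<close> reads every coefficient as such a count.\<close>

lemma exists_set_with_descents:
  assumes "\<And>i j. \<lbrakk>1 \<le> i; i \<le> j; j < n\<rbrakk> \<Longrightarrow> f (i, j) + 2 \<le> n"
  shows "\<exists>S. S \<subseteq> Sym n \<and> (\<forall>w\<in>S. \<exists>i j. 1 \<le> i \<and> i \<le> j \<and> j < n \<and> Des n w = {i, j}) \<and>
    (\<forall>C. C \<subseteq> {1..<n} \<longrightarrow> card {w \<in> S. Des n w \<subseteq> C} = sum f (ordered_pairs C))"
proof -
  have "\<forall>p\<in>ordered_pairs {1..<n}. \<exists>W. W \<subseteq> {w \<in> Sym n. Des n w = {fst p, snd p}} \<and> card W = f p"
    using exists_perms assms by (auto simp: ordered_pairs_def)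
  then obtain W where W: "\<And>p. p \<in> ordered_pairs {1..<n} \<Longrightarrow> W p \<subseteq> {w \<in> Sym n. Des n w = {fst p, snd p}} \<and> card (W p) = f p"
    by metis
  define S where "S = (\<Union>p\<in>ordered_pairs {1..<n}. W p)"
  have des: "Des n w = {fst p, snd p}" if "p \<in> ordered_pairs {1..<n}" "w \<in> W p" for p w
    using W[OF that(1)] that(2) by auto
  have inj: "p = p'" if "p \<in> ordered_pairs A" "p' \<in> ordered_pairs A" "{fst p, snd p} = {fst p', snd p'}" for p p' A
    using that by (auto simp: ordered_pairs_def doubleton_eq_iff)
  have "card {w \<in> S. Des n w \<subseteq> C} = sum f (ordered_pairs C)" if C: "C \<subseteq> {1..<n}" for C
  proof -
    have sub: "ordered_pairs C \<subseteq> ordered_pairs {1..<n}" using C by (auto simp: ordered_pairs_def)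
    have "{w \<in> S. Des n w \<subseteq> C} = (\<Union>p\<in>ordered_pairs C. W p)"
    proof (intro set_eqI iffI)
      fix w assume "w \<in> {w \<in> S. Des n w \<subseteq> C}"
      then obtain p where p: "p \<in> ordered_pairs {1..<n}" "w \<in> W p" "Des n w \<subseteq> C" by (auto simp: S_def)
      then have "p \<in> ordered_pairs C" using des[OF p(1,2)] by (auto simp: ordered_pairs_def)
      then show "w \<in> (\<Union>p\<in>ordered_pairs C. W p)" using p by blast
    next
      fix w assume "w \<in> (\<Union>p\<in>ordered_pairs C. W p)"
      then obtain p where p: "p \<in> ordered_pairs C" "w \<in> W p" by blast
      have p': "p \<in> ordered_pairs {1..<n}" using p(1) sub by blast
      have "{fst p, snd p} \<subseteq> C" using p(1) by (auto simp: ordered_pairs_def)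
      then have "Des n w \<subseteq> C" using des[OF p' p(2)] by simp
      moreover have "w \<in> S" using p' p(2) by (auto simp: S_def)
      ultimately show "w \<in> {w \<in> S. Des n w \<subseteq> C}" by simp
    qed
    also have "card \<dots> = (\<Sum>p\<in>ordered_pairs C. card (W p))"
    proof (rule card_UN_disjoint)
      show "finite (ordered_pairs C)" by (rule finite_ordered_pairs[OF finite_subset[OF C]]) simp
      show "\<forall>p\<in>ordered_pairs C. finite (W p)"
      proof
        fix p assume "p \<in> ordered_pairs C"
        then have "W p \<subseteq> Sym n" using W[of p] sub by blast
        then show "finite (W p)" by (rule finite_subset) simp
      qed
      show "\<forall>p\<in>ordered_pairs C. \<forall>p'\<in>ordered_pairs C. p \<noteq> p' \<longrightarrow> W p \<inter> W p' = {}"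
      proof (intro ballI impI)
        fix p p' assume p: "p \<in> ordered_pairs C" "p' \<in> ordered_pairs C" "p \<noteq> p'"
        show "W p \<inter> W p' = {}"
        proof (rule ccontr)
          assume "\<not> ?thesis"
          then obtain w where "w \<in> W p" "w \<in> W p'" by blast
          then have "{fst p, snd p} = {fst p', snd p'}"
            using des[OF subsetD[OF sub p(1)]] des[OF subsetD[OF sub p(2)]] by metis
          then show False using inj[OF p(1,2)] p(3) by blast
        qed
      qed
    qed
    also have "\<dots> = sum f (ordered_pairs C)" using W sub by (intro sum.cong) auto
    finally show ?thesis .
  qed
  moreover have "S \<subseteq> Sym n" using W by (auto simp: S_def)
  moreover have "\<exists>i j. 1 \<le> i \<and> i \<le> j \<and> j < n \<and> Des n w = {i, j}" if "w \<in> S" for w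
  proof -
    obtain p where p: "p \<in> ordered_pairs {1..<n}" "w \<in> W p" using \<open>w \<in> S\<close> unfolding S_def by blast
    then show ?thesis using des[OF p] by (intro exI[of _ "fst p"] exI[of _ "snd p"]) (auto simp: ordered_pairs_def)
  qed
  ultimately show ?thesis by blast
qed

text \<open>If \<open>C\<close> is read as the set of cuts of a composition of \<open>n\<close>,
  these are the places of the parts equal to one.\<close>

definition unit_gaps :: "nat \<Rightarrow> nat set \<Rightarrow> nat set" where
  "unit_gaps n C = {j \<in> {1..n}. (j = 1 \<or> j - 1 \<in> C) \<and> (j = n \<or> j \<in> C)}"

text \<open>These are the coefficients at \<open>F\<^bsub>n,{i,j}\<^esub>\<close> of
  \<open>a s\<^bsub>(n-1,1)\<^esub> + b s\<^bsub>(n-2,1,1)\<^esub> + d B\<close>, where the coefficient of \<open>B\<close> at a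
  monomial (in more than one variable) is the number of its exponents equal to one.\<close>
definition pair_weight :: "int \<Rightarrow> int \<Rightarrow> int \<Rightarrow> nat \<Rightarrow> nat \<times> nat \<Rightarrow> int" where
  "pair_weight a b d n = (\<lambda>(i, j). (if i = j then a + (if i = 1 then d else 0) + (if i = n - 1 then d else 0)
      else b + (if j = i + 1 then d else 0)))"

text \<open>The sets \<open>{1}\<close>, \<open>{n - 1}\<close> and \<open>{j - 1, j}\<close> carry
  \<open>d\<close>, and lying inside \<open>C\<close> they correspond to the unit parts at 1, at
  \<open>n\<close> and at \<open>j\<close>. Hence \<open>d\<close> is counted once per unit
  gap.\<close>

lemma sum_pair_weight:
  assumes C: "C \<subseteq> {1..<n}" and n: "3 \<le> n"
  shows "2 * (\<Sum>p\<in>ordered_pairs C. pair_weight a b d n p)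
    = 2 * a * int (card C) + b * (int (card C) * int (card C) - int (card C)) + 2 * d * int (card (unit_gaps n C))"
proof -
  have fin: "finite C" using C finite_subset by blast
  define L where "L = {(i, j). i \<in> C \<and> j \<in> C \<and> i < j}"
  define diag where "diag = (\<lambda>i. (i, i)) ` C"
  have finL: "finite L" by (rule finite_subset[of _ "C \<times> C"]) (auto simp: L_def fin)
  have split: "ordered_pairs C = diag \<union> L" "diag \<inter> L = {}"
    by (auto simp: ordered_pairs_def diag_def L_def)
  have injd: "inj_on (\<lambda>i. (i, i)) C" by (auto simp: inj_on_def)
  have "C \<times> C = diag \<union> (L \<union> prod.swap ` L)" by (auto simp: diag_def L_def image_iff)
  moreover have "diag \<inter> (L \<union> prod.swap ` L) = {}" "L \<inter> prod.swap ` L = {}" by (auto simp: diag_def L_def)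
  ultimately have "card (C \<times> C) = card diag + (card L + card (prod.swap ` L))"
    using fin finL by (simp add: card_Un_disjoint diag_def)
  moreover have "card (prod.swap ` L) = card L" by (rule card_image) (auto simp: inj_on_def)
  ultimately have cardL: "card C * card C = card C + 2 * card L"
    using card_image[OF injd] by (simp add: diag_def card_cartesian_product)
  have D: "(\<Sum>p\<in>diag. pair_weight a b d n p) = a * int (card C) + (if 1 \<in> C then d else 0) + (if n - 1 \<in> C then d else 0)"
    unfolding diag_def sum.reindex[OF injd] using fin
    by (simp add: pair_weight_def comp_def sum.distrib sum.delta mult.commute)
  define Adj where "Adj = {i \<in> C. i + 1 \<in> C}"
  have Adj: "{p \<in> L. snd p = fst p + 1} = (\<lambda>i. (i, i + 1)) ` Adj"
    by (auto simp: L_def Adj_def)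
  have "(\<Sum>p\<in>L. pair_weight a b d n p) = (\<Sum>p\<in>L. b + (if snd p = fst p + 1 then d else 0))"
    by (rule sum.cong) (auto simp: pair_weight_def L_def)
  also have "\<dots> = b * int (card L) + (\<Sum>p\<in>{p \<in> L. snd p = fst p + 1}. d)"
    unfolding sum.inter_filter[OF finL] by (simp add: sum.distrib mult.commute)
  also have "(\<Sum>p\<in>{p \<in> L. snd p = fst p + 1}. d) = d * int (card Adj)"
    unfolding Adj by (subst sum.reindex) (auto simp: inj_on_def)
  finally have S: "(\<Sum>p\<in>L. pair_weight a b d n p) = b * int (card L) + d * int (card Adj)" .
  have U: "int (card (unit_gaps n C)) = int (card Adj) + (if 1 \<in> C then 1 else 0) + (if n - 1 \<in> C then 1 else 0)"
  proof -
    have eq: "unit_gaps n C = (Suc ` Adj) \<union> ((if 1 \<in> C then {1} else {}) \<union> (if n - 1 \<in> C then {n} else {}))"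
    proof (intro set_eqI iffI)
      fix j assume "j \<in> unit_gaps n C"
      then have j: "j \<in> {1..n}" "j = 1 \<or> j - 1 \<in> C" "j = n \<or> j \<in> C" by (auto simp: unit_gaps_def)
      consider "j = 1" | "j = n" | "j \<noteq> 1" "j \<noteq> n" by blast
      then show "j \<in> (Suc ` Adj) \<union> ((if 1 \<in> C then {1} else {}) \<union> (if n - 1 \<in> C then {n} else {}))"
      proof cases
        case 3
        then have "j - 1 \<in> Adj" "j = Suc (j - 1)" using j by (auto simp: Adj_def)
        then show ?thesis by blast
      qed (use j n in auto)
    qed (use C n in \<open>auto simp: unit_gaps_def Adj_def split: if_splits\<close>)
    have "Suc ` Adj \<inter> ((if 1 \<in> C then {1} else {}) \<union> (if n - 1 \<in> C then {n} else {})) = {}"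
      using C by (auto simp: Adj_def split: if_splits)
    then have "card (unit_gaps n C) = card (Suc ` Adj) + card ((if 1 \<in> C then {1} else {}) \<union> (if n - 1 \<in> C then {n} else {}))"
      unfolding eq using fin by (intro card_Un_disjoint) (auto simp: Adj_def)
    moreover have "card (Suc ` Adj) = card Adj" by (rule card_image) simp
    ultimately show ?thesis using n by auto
  qed
  have "2 * int (card L) = int (card C) * int (card C) - int (card C)"
    using arg_cong[OF cardL, of int] by simp
  then have "b * (2 * int (card L)) = b * (int (card C) * int (card C) - int (card C))" by simp
  moreover have "(\<Sum>p\<in>ordered_pairs C. pair_weight a b d n p) = (\<Sum>p\<in>diag. pair_weight a b d n p) + (\<Sum>p\<in>L. pair_weight a b d n p)"
    unfolding split(1) using split(2) fin finL by (intro sum.union_disjoint) (auto simp: diag_def)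
  ultimately show ?thesis unfolding D S U by (simp add: algebra_simps)
qed

section \<open>Reading exponents off a sorted word\<close>

lemma card_strict_cuts:
  assumes "sorted xs" "xs \<noteq> []"
  shows "card (set xs) = Suc (card (strict_cuts xs))"
proof -
  let ?P = "insert 0 (strict_cuts xs)"
  have lt: "xs ! i < xs ! j" if "i < j" "j \<in> strict_cuts xs" for i j
  proof -
    have "xs ! i \<le> xs ! (j - 1)" using that assms(1) by (intro sorted_nth_mono) (auto simp: strict_cuts_def)
    then show ?thesis using that(2) by (auto simp: strict_cuts_def)
  qed
  have inj: "inj_on ((!) xs) ?P"
  proof (rule linorder_inj_onI')
    fix i j assume "i \<in> ?P" "j \<in> ?P" "i < j"
    then show "xs ! i \<noteq> xs ! j" using lt[of i j] by auto
  qed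
  have img: "(!) xs ` ?P = set xs"
  proof
    show "(!) xs ` ?P \<subseteq> set xs" using assms(2) by (auto simp: strict_cuts_def)
    show "set xs \<subseteq> (!) xs ` ?P"
    proof
      fix x assume "x \<in> set xs"
      then obtain k where k: "k < length xs" "xs ! k = x" by (auto simp: in_set_conv_nth)
      define i where "i = (LEAST i. i < length xs \<and> xs ! i = x)"
      have i: "i < length xs" "xs ! i = x" using LeastI[of "\<lambda>i. i < length xs \<and> xs ! i = x" k] k by (auto simp: i_def)
      have "i \<in> ?P"
      proof (cases "i = 0")
        case False
        then have "\<not> (i - 1 < length xs \<and> xs ! (i - 1) = x)" unfolding i_def by (intro not_less_Least) auto
        moreover have "xs ! (i - 1) \<le> xs ! i" using assms(1) i by (intro sorted_nth_mono) auto
        ultimately show ?thesis using i False by (auto simp: strict_cuts_def)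
      qed simp
      then show "x \<in> (!) xs ` ?P" using i by blast
    qed
  qed
  have "card ?P = card (set xs)" using card_image[OF inj] unfolding img ..
  moreover have "0 \<notin> strict_cuts xs" "finite (strict_cuts xs)" by (auto simp: strict_cuts_def)
  ultimately show ?thesis by simp
qed

lemma count_mset_card: "count (mset xs) k = card {i. i < length xs \<and> xs ! i = k}"
  by (simp add: count_mset count_list_eq_length_filter length_filter_conv_card) (metis eq_commute)

lemma card_unit_gaps:
  assumes "sorted xs" "length xs = n"
  shows "card (unit_gaps n (strict_cuts xs)) = card {k. count (mset xs) k = 1}"
proof -
  let ?U = "unit_gaps n (strict_cuts xs)"
  have lt: "xs ! i < xs ! j" if "i < j" "j \<in> strict_cuts xs" for i j
  proof -
    have "xs ! i \<le> xs ! (j - 1)" using that assms(1) by (intro sorted_nth_mono) (auto simp: strict_cuts_def)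
    then show ?thesis using that(2) by (auto simp: strict_cuts_def)
  qed
  have lt': "xs ! (j - 1) < xs ! i" if "j \<in> strict_cuts xs" "j \<le> i" "i < n" for i j
  proof -
    have "xs ! j \<le> xs ! i" using that assms by (intro sorted_nth_mono) auto
    then show ?thesis using that(1) by (auto simp: strict_cuts_def)
  qed
  have uniq: "i = j - 1" if "j \<in> ?U" "i < n" "xs ! i = xs ! (j - 1)" for i j
  proof (rule ccontr)
    assume "i \<noteq> j - 1"
    then consider "i < j - 1" | "j \<le> i" by linarith
    then show False
    proof cases
      case 1
      then have "j - 1 \<in> strict_cuts xs" using that(1) by (auto simp: unit_gaps_def)
      then show False using lt[OF 1] that(3) by simp
    next
      case 2
      then have "j \<in> strict_cuts xs" using that by (auto simp: unit_gaps_def)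
      then show False using lt'[OF _ 2 that(2)] that(3) by simp
    qed
  qed
  have "bij_betw (\<lambda>j. xs ! (j - 1)) ?U {k. count (mset xs) k = 1}"
    unfolding bij_betw_def
  proof
    show "inj_on (\<lambda>j. xs ! (j - 1)) ?U"
    proof (rule inj_onI)
      fix i j assume ij: "i \<in> ?U" "j \<in> ?U" "xs ! (i - 1) = xs ! (j - 1)"
      have b: "1 \<le> i" "i \<le> n" "1 \<le> j" using ij(1,2) by (auto simp: unit_gaps_def)
      have "i - 1 = j - 1" by (rule uniq[OF ij(2) _ ij(3)]) (use b in simp)
      then show "i = j" using b by simp
    qed
    show "(\<lambda>j. xs ! (j - 1)) ` ?U = {k. count (mset xs) k = 1}"
    proof (intro set_eqI iffI)
      fix k assume "k \<in> (\<lambda>j. xs ! (j - 1)) ` ?U"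
      then obtain j where j: "j \<in> ?U" "k = xs ! (j - 1)" by blast
      then have "j - 1 < n" by (auto simp: unit_gaps_def)
      then have "{i. i < length xs \<and> xs ! i = k} = {j - 1}" using j uniq[OF j(1)] assms(2) by auto
      then show "k \<in> {k. count (mset xs) k = 1}" by (simp add: count_mset_card)
    next
      fix k assume "k \<in> {k. count (mset xs) k = 1}"
      then obtain i where i: "{i. i < length xs \<and> xs ! i = k} = {i}"
        by (auto simp: count_mset_card card_1_singleton_iff)
      then have ik: "i < n" "xs ! i = k" using assms(2) by auto
      have ne: "xs ! i' \<noteq> k" if "i' < n" "i' \<noteq> i" for i'
        using i that assms(2) by auto
      have "i \<in> strict_cuts xs" if "i \<noteq> 0"
      proof -
        have "xs ! (i - 1) \<noteq> k" by (rule ne) (use ik that in auto)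
        then show ?thesis
          using sorted_nth_mono[OF assms(1), of "i - 1" i] ik that assms(2) by (auto simp: strict_cuts_def)
      qed
      moreover have "Suc i \<in> strict_cuts xs" if "Suc i \<noteq> n"
      proof -
        have "xs ! Suc i \<noteq> k" by (rule ne) (use ik that in auto)
        then show ?thesis
          using sorted_nth_mono[OF assms(1), of i "Suc i"] ik that assms(2) by (auto simp: strict_cuts_def)
      qed
      ultimately have "Suc i \<in> ?U" using ik by (auto simp: unit_gaps_def)
      then show "k \<in> (\<lambda>j. xs ! (j - 1)) ` ?U" using ik by (intro image_eqI[of _ _ "Suc i"]) auto
    qed
  qed
  then show ?thesis by (rule bij_betw_same_card)
qed

lemma exists_list_comp_bij:
  assumes "bij pi" "length xs = n" "\<forall>k. count (mset xs) k = (alpha \<circ> pi) k"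
  shows "\<exists>ys. length ys = n \<and> (\<forall>k. count (mset ys) k = alpha k)"
proof (intro exI conjI allI)
  show "length (map pi xs) = n" using assms(2) by simp
  fix k
  obtain x where x: "k = pi x" using assms(1) by (metis bij_pointE)
  have "count (mset (map pi xs)) k = count (mset xs) x"
    unfolding x using bij_is_inj[OF assms(1)] by (induction xs) (auto simp: inj_eq)
  then show "count (mset (map pi xs)) k = alpha k" using assms(3) x by simp
qed

text \<open>In degree n the coefficients depend only on how many exponents are positive and how many
  equal one, and permuting variables changes neither. The bounds keep the four possible weights
  \<open>a\<close>, \<open>a + d\<close>, \<open>b\<close>, \<open>b + d\<close> between 0 and
  \<open>n - 2\<close>, the range served by \<open>exists_perms\<close>.\<close>

theorem exists_symmetric_set:
  fixes a b d :: int
  assumes n: "4 \<le> n"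
    and bounds: "0 \<le> a" "0 \<le> b" "0 \<le> a + d" "0 \<le> b + d"
      "a + 2 \<le> int n" "b + 2 \<le> int n" "a + d + 2 \<le> int n" "b + d + 2 \<le> int n"
    and p: "2 * int p = 2 * a * (int n - 1) + b * ((int n - 1) * (int n - 2)) + 2 * d * int n"
  shows "\<exists>S. S \<subseteq> Sym n \<and> symmetric_set n S \<and> card S = p \<and> iota n \<notin> S \<and> delta n \<notin> S"
proof -
  define f where "f p = nat (pair_weight a b d n p)" for p
  have nn: "0 \<le> pair_weight a b d n p" "pair_weight a b d n p + 2 \<le> int n" for p
    using bounds n by (auto simp: pair_weight_def split: prod.splits)
  have f: "int (f p) = pair_weight a b d n p" for p using nn(1) by (simp add: f_def)
  have "f (i, j) + 2 \<le> n" for i j using nn[of "(i, j)"] by (simp add: f_def)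
  then have "\<exists>S. S \<subseteq> Sym n \<and> (\<forall>w\<in>S. \<exists>i j. 1 \<le> i \<and> i \<le> j \<and> j < n \<and> Des n w = {i, j}) \<and>
    (\<forall>C. C \<subseteq> {1..<n} \<longrightarrow> card {w \<in> S. Des n w \<subseteq> C} = sum f (ordered_pairs C))"
    by (intro exists_set_with_descents)
  then obtain S where S: "S \<subseteq> Sym n" "\<forall>w\<in>S. \<exists>i j. 1 \<le> i \<and> i \<le> j \<and> j < n \<and> Des n w = {i, j}"
    "\<forall>C. C \<subseteq> {1..<n} \<longrightarrow> card {w \<in> S. Des n w \<subseteq> C} = sum f (ordered_pairs C)"
    by (elim exE conjE)
  have fin: "finite S" by (rule finite_subset[OF S(1) finite_Sym])
  have card_C: "2 * int (card {w \<in> S. Des n w \<subseteq> C})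
    = 2 * a * int (card C) + b * (int (card C) * int (card C) - int (card C)) + 2 * d * int (card (unit_gaps n C))"
    if "C \<subseteq> {1..<n}" for C
    unfolding S(3)[rule_format, OF that] using sum_pair_weight[OF that, of a b d] n by (simp add: f)
  have Q: "2 * int (Q_coeff n S alpha) = 2 * a * (int (card {k. 0 < alpha k}) - 1)
      + b * ((int (card {k. 0 < alpha k}) - 1) * (int (card {k. 0 < alpha k}) - 1) - (int (card {k. 0 < alpha k}) - 1))
      + 2 * d * int (card {k. alpha k = 1})"
    if xs: "length xs = n" "\<forall>k. count (mset xs) k = alpha k" for alpha xs
  proof -
    define ys where "ys = sort xs"
    have ys: "sorted ys" "length ys = n" "\<And>k. alpha k = count (mset ys) k" using xs by (auto simp: ys_def)
    have sub: "strict_cuts ys \<subseteq> {1..<n}" using ys(2) by (auto simp: strict_cuts_def)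
    have "set ys = {k. 0 < alpha k}" using ys(3) by (auto simp: count_greater_zero_iff)
    then have "int (card (strict_cuts ys)) = int (card {k. 0 < alpha k}) - 1"
      using card_strict_cuts[OF ys(1)] ys(2) n by (cases "ys = []") auto
    moreover have "card (unit_gaps n (strict_cuts ys)) = card {k. alpha k = 1}"
      using card_unit_gaps[OF ys(1,2)] ys(3) by simp
    ultimately show ?thesis
      using card_C[OF sub] Q_coeff_card[OF fin ys(1,2,3)] by simp
  qed
  have "symmetric_set n S" unfolding symmetric_set_def
  proof (intro allI impI)
    fix pi :: "nat \<Rightarrow> nat" and alpha :: "nat \<Rightarrow> nat"
    assume pi: "bij pi"
    show "Q_coeff n S (alpha \<circ> pi) = Q_coeff n S alpha"
    proof (cases "\<exists>xs. length xs = n \<and> (\<forall>k. count (mset xs) k = alpha k)")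
      case True
      then obtain xs where xs: "length xs = n" "\<forall>k. count (mset xs) k = alpha k" by blast
      have "alpha = (alpha \<circ> pi) \<circ> inv pi" using pi by (auto simp: fun_eq_iff bij_is_surj surj_f_inv_f)
      then obtain ys where ys: "length ys = n" "\<forall>k. count (mset ys) k = (alpha \<circ> pi) k"
        using exists_list_comp_bij[OF bij_imp_bij_inv[OF pi] xs(1), of "alpha \<circ> pi"] xs(2) by metis
      have "card {k. P ((alpha \<circ> pi) k)} = card {k. P (alpha k)}" for P
      proof -
        have "pi ` {k. P ((alpha \<circ> pi) k)} = {k. P (alpha k)}"
          using pi by (auto simp: image_iff) (metis bij_pointE)
        then show ?thesis using card_image[OF inj_on_subset[OF bij_is_inj[OF pi]]] by (metis subset_UNIV)
      qed
      note same = this[of "\<lambda>x. 0 < x"] this[of "\<lambda>x. x = 1"]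
      have "2 * int (Q_coeff n S (alpha \<circ> pi)) = 2 * int (Q_coeff n S alpha)"
        unfolding Q[OF xs] Q[OF ys] same ..
      then show ?thesis by simp
    next
      case False
      then have "\<not> (\<exists>xs. length xs = n \<and> (\<forall>k. count (mset xs) k = (alpha \<circ> pi) k))"
        using exists_list_comp_bij[OF pi] by blast
      then show ?thesis using False F_coeff_eq_0 by (simp add: Q_coeff_def)
    qed
  qed
  moreover have "card S = p"
  proof -
    have "{w \<in> S. Des n w \<subseteq> {1..<n}} = S" using Des_subset by auto
    moreover have "unit_gaps n {1..<n} = {1..n}" by (auto simp: unit_gaps_def)
    ultimately have "2 * int (card S) = 2 * a * (int n - 1) + b * ((int n - 1) * (int n - 1) - (int n - 1)) + 2 * d * int n"
      using card_C[of "{1..<n}"] n by (simp add: of_nat_diff)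
    then show ?thesis using p by (simp add: algebra_simps)
  qed
  moreover have "iota n \<notin> S"
  proof
    assume "iota n \<in> S"
    then show False using S(2) by (auto simp: Des_def iota_def)
  qed
  moreover have "delta n \<notin> S"
  proof
    assume "delta n \<in> S"
    then obtain i j where "Des n (delta n) = {i, j}" using S(2) by blast
    moreover have "{1, 2, 3} \<subseteq> Des n (delta n)" using n by (auto simp: Des_def delta_def)
    ultimately have "card {1, 2, 3 :: nat} \<le> card {i, j}" by (metis card_mono finite.emptyI finite.insertI)
    then show False using card_insert_le_m1[of 2 "{j}" i] by simp
  qed
  ultimately show ?thesis using S(1) by blast
qed

theorem theorem1p2:
  fixes n p :: nat
  assumes "n \<ge> 52" and "p < (n - 1) * (n - 3)"
  defines "C1 \<equiv> (\<exists>q r :: int. 0 \<le> r \<and> r \<le> q \<and> q < int n - 3 \<and> int p = q * int n - r)"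
      and "C2 \<equiv> (even n \<and> (\<exists>c :: nat. p = n * (n - 3) div 2 + c * (n - 1)))"
      and "C3 \<equiv> (odd n \<and> (\<exists>c :: nat. p = (n - 1 choose 2) + c * n))"
  shows "(\<exists>S. S \<subseteq> Sym n \<and> symmetric_set n S \<and> card S = p \<and>
              iota n \<notin> S \<and> delta n \<notin> S)
         \<longleftrightarrow> ((C1 \<and> \<not> C2 \<and> \<not> C3) \<or> (\<not> C1 \<and> C2 \<and> \<not> C3) \<or> (\<not> C1 \<and> \<not> C2 \<and> C3))"
proof -
  let ?ex = "\<exists>S. S \<subseteq> Sym n \<and> symmetric_set n S \<and> card S = p \<and> iota n \<notin> S \<and> delta n \<notin> S"
  have n: "int (n - 1) = int n - 1" "int (n - 2) = int n - 2" "int (n - 3) = int n - 3" "52 \<le> int n"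
    using assms(1) by auto
  have p: "int p < (int n - 1) * (int n - 3)"
    using assms(2) n by (metis of_nat_less_iff of_nat_mult)
  \<comment> \<open>Both exceptional families are treated at once: \<open>e\<close> is 0 for the
    even one, and \<open>2 + 2 * int c\<close> for the odd one after rewriting it in terms of n (n -
    3) and n - 1.\<close>
  have c_bound: "int c + 3 \<le> int n - 2" if "2 * int p = int n * (int n - 3) + e + 2 * int c * (int n - 1)" "0 \<le> e" for c e
  proof (rule ccontr)
    assume "\<not> ?thesis"
    then have "(int n - 4) * (2 * (int n - 1)) \<le> int c * (2 * (int n - 1))"
      using n by (intro mult_right_mono) auto
    then have "2 * (int n * int n) + 8 + 2 * int c \<le> 10 * int n + 2 * (int c * int n)"
      by (simp add: algebra_simps)
    moreover have "2 * int p + 3 * int n + 2 * int c = int n * int n + e + 2 * (int c * int n)"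
      using that(1) by (simp add: algebra_simps)
    moreover have "int p + 4 * int n < int n * int n + 3" using p by (simp add: algebra_simps)
    moreover have "5 * int n \<le> int n * int n" using n by (intro mult_right_mono) auto
    ultimately show False using that(2) by linarith
  qed
  have 12: "\<not> (C1 \<and> C2)"
    unfolding C1_def C2_def using case1_case2_exclusive[OF assms(1,2)] by blast
  have 13: "\<not> (C1 \<and> C3)"
    unfolding C1_def C3_def using case1_case3_exclusive[OF assms(1)] by blast
  have 23: "\<not> (C2 \<and> C3)" unfolding C2_def C3_def by blast
  have "C1 \<or> C2 \<or> C3" if ?ex
  proof -
    obtain S where S: "S \<subseteq> Sym n" "symmetric_set n S" "card S = p" "iota n \<notin> S" "delta n \<notin> S"
      using \<open>?ex\<close> by blast
    then have "size_form (int n) (int p)"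
      using size_form_symmetric_set[OF assms(1) S(1,2,4,5)] assms(2) by simp
    then show ?thesis unfolding C1_def C2_def C3_def by (rule size_form_imp_cases[OF assms(1,2)])
  qed
  moreover have ?ex if C1
  proof -
    obtain q r where qr: "0 \<le> r" "r \<le> q" "q < int n - 3" "int p = q * int n - r"
      using \<open>C1\<close> unfolding C1_def by blast
    show ?thesis
    proof (rule exists_symmetric_set)
      \<comment> \<open>The choice is r copies of s_(n-1,1) and q - r copies of the function
        counting exponents equal to one.\<close>
      show "2 * int p = 2 * r * (int n - 1) + 0 * ((int n - 1) * (int n - 2)) + 2 * (q - r) * int n"
        using qr(4) by (simp add: algebra_simps)
    qed (use qr n assms(1) in auto)
  qed
  moreover have ?ex if C2
  proof -
    obtain c where c: "even n" "p = n * (n - 3) div 2 + c * (n - 1)"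
      using \<open>C2\<close> unfolding C2_def by blast
    then have "2 * p = n * (n - 3) + 2 * c * (n - 1)" by simp
    then have "int (2 * p) = int (n * (n - 3) + 2 * c * (n - 1))" by (rule arg_cong)
    then have c2: "2 * int p = int n * (int n - 3) + 2 * int c * (int n - 1)" using n by simp
    show ?thesis
    proof (rule exists_symmetric_set)
      \<comment> \<open>This is c s_(n-1,1) + s_(n-2,2): in the latter, inner singletons and
        non-adjacent pairs have weight one, extreme singletons and adjacent pairs weight zero, hence
        \<open>d = - 1\<close>.\<close>
      show "2 * int p = 2 * (int c + 1) * (int n - 1) + 1 * ((int n - 1) * (int n - 2)) + 2 * (- 1) * int n"
        using c2 by (simp add: algebra_simps)
    qed (use c_bound[of 0 c] c2 n assms(1) in auto)
  qed
  moreover have ?ex if C3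
  proof -
    obtain c where c: "odd n" "p = (n - 1 choose 2) + c * n"
      using \<open>C3\<close> unfolding C3_def by blast
    obtain m where "n = 2 * m + 1" using c(1) oddE by blast
    then have "2 * (n - 1 choose 2) = (n - 1) * (n - 2)" by (simp add: choose_two)
    then have "2 * p = (n - 1) * (n - 2) + 2 * c * n" using c by simp
    then have "int (2 * p) = int ((n - 1) * (n - 2) + 2 * c * n)" by (rule arg_cong)
    then have c2: "2 * int p = (int n - 1) * (int n - 2) + 2 * int c * int n" using n by simp
    then have "2 * int p = int n * (int n - 3) + (2 + 2 * int c) + 2 * int c * (int n - 1)"
      by (simp add: algebra_simps)
    then have "int c + 3 \<le> int n - 2" by (rule c_bound) simp
    show ?thesis
    proof (rule exists_symmetric_set)
      \<comment> \<open>Here s_(n-2,1,1) is combined with c copies of the function counting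
        exponents equal to one.\<close>
      show "2 * int p = 2 * 0 * (int n - 1) + 1 * ((int n - 1) * (int n - 2)) + 2 * int c * int n"
        using c2 by simp
    qed (use \<open>int c + 3 \<le> int n - 2\<close> n assms(1) in auto)
  qed
  ultimately have "?ex \<longleftrightarrow> C1 \<or> C2 \<or> C3" by blast
  then show ?thesis using 12 13 23 by blast
qed

end
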